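(* Let $d_A,d_B\ge 1$ be integers and let $\rho$ be any entangled quantum state on $\mathbb{C}^{d_A}\otimes\mathbb{C}^{d_B}$. Let $\{|\varphi_s\rangle\}_{s=1}^{d_A^2}\subset\mathbb{C}^{d_A}$ and $\{|\psi_t\rangle\}_{t=1}^{d_B^2}\subset\mathbb{C}^{d_B}$ be families of unit vectors whose density matrices are informationally complete, i.e. $\{|\varphi_s\rangle\langle\varphi_s|\}_s$ spans the space of linear operators on $\mathbb{C}^{d_A}$ and $\{|\psi_t\rangle\langle\psi_t|\}_t$ spans the space of linear operators on $\mathbb{C}^{d_B}$. Then there exist real coefficients $\beta^\rho_{st}$ ($1\le s\le d_A^2$, $1\le t\le d_B^2$) such that the functional $$I^\rho(P):=\sum_{s,t}\beta^\rho_{st}\,P(1,1\,|\,|\varphi_s\rangle,|\psi_t\rangle)$$ has the following two properties: (i) $I^\rho(P)\ge 0$ for every LOCC correlation $P(a,b\,|\,|\varphi_s\rangle,|\psi_t\rangle)$ with outputs $a,b\in\{0,1\}$ on the inputs $|\varphi_s\rangle,|\psi_t\rangle$; (ii) $I^\rho(P_\rho)<0$, where $P_\rho$ is the quantum correlation obtained from $\rho$ when Alice and Bob each perform the projection onto a maximally entangled state, that is $$P_\rho(a,b\,|\,|\varphi_s\rangle,|\psi_t\rangle)=\mathrm{tr}\Big[\big(\mathcal{A}^{A'A}_a\otimes\mathcal{B}^{BB'}_b\big)\cdot\big(|\varphi_s\rangle\langle\varphi_s|^{A'}\otimes\rho^{AB}\otimes|\psi_t\rangle\langle\psi_t|^{B'}\big)\Big],\qquad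 a,b\in\{0,1\},$$ with $\mathcal{A}_1^{A'A}=|\Phi^+_{d_A}\rangle\langle\Phi^+_{d_A}|$, $\mathcal{A}_0^{A'A}=\mathbb{1}-\mathcal{A}_1^{A'A}$, $\mathcal{B}_1^{BB'}=|\Phi^+_{d_B}\rangle\langle\Phi^+_{d_B}|$, $\mathcal{B}_0^{BB'}=\mathbb{1}-\mathcal{B}_1^{BB'}$.
   Context: All Hilbert spaces are finite-dimensional. A quantum state on $\mathbb{C}^{d_A}\otimes\mathbb{C}^{d_B}$ is a positive semidefinite operator of trace 1; it is separable if it is a convex combination of product states $\sigma\otimes\tau$ (with $\sigma,\tau$ states on the two factors), and entangled otherwise. Systems: $A',A$ have Hilbert space $\mathbb{C}^{d_A}$ and $B,B'$ have Hilbert space $\mathbb{C}^{d_B}$, ordered as $A'\otimes A\otimes B\otimes B'$; superscripts indicate the systems on which an operator acts. With $\{|k\rangle\}$ the computational basis of $\mathbb{C}^d$, $|\Phi^+_d\rangle=\frac{1}{\sqrt d}\sum_{k=0}^{d-1}|k\rangle\otimes|k\rangle$. LOCC correlations (local operations, shared randomness and unrestricted classical communication). Alice receives the system $A'$ in state $|\varphi_s\rangle$ and Bob the system $B'$ in state $|\psi_t\rangle$; they share no entangled state and are not told the labels $s,t$, so the protocol does not depend on $s,t$. A finite-round LOCC protocol consists of a shared random variable $\lambda$ with a probability distribution $\mu$, independent of $s,t$, and a finite number of rounds. In each round one of the parties applies to her/his own current local system a measurement with finitely many outcomes, given by Kraus operators $\{K_m\}_m$ with $\sum_m K_m^\dagger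 K_m=\mathbb{1}$ (the output space may be any finite-dimensional space), and announces the outcome $m$ to the other party. Which party acts and which Kraus operators are used may depend on $\lambda$ and on all previously announced outcomes. After the last round, outputs $(a,b)$ are determined as a function of $\lambda$ and the full transcript of announced outcomes. $P(a,b\,|\,|\varphi_s\rangle,|\psi_t\rangle)$ is the probability (averaged over $\lambda$) that the outputs are $(a,b)$ when the initial state is $|\varphi_s\rangle\otimes|\psi_t\rangle$. The number of rounds and amount of communication are not bounded. An LOCC correlation is any $P$ arising from such a protocol, or a pointwise limit of such correlations (which covers protocols with infinitely many rounds). *)

theory Defs
  imports "HOL-Probability.Probability_Measure" "Jordan_Normal_Form.Schur_Decomposition"
begin

unbundle no vec_syntax and no inner_syntax

section \<open>Linear algebra\<close>

text \<open>Entrywise sum of a finite family of matrices of size \<open>nr \<times> nc\<close>.\<close>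

definition mat_sum :: "nat \<Rightarrow> nat \<Rightarrow> ('i \<Rightarrow> complex mat) \<Rightarrow> 'i set \<Rightarrow> complex mat" where
  "mat_sum nr nc f I = mat nr nc (\<lambda>ij. \<Sum>k\<in>I. f k $$ ij)"

definition mat_trace :: "complex mat \<Rightarrow> complex" where
  "mat_trace A = (\<Sum>i<dim_row A. A $$ (i, i))"

text \<open>Tensor products, in the product basis ordered lexicographically. With this ordering
  \<open>kron_mat\<close> and \<open>kron_vec\<close> are strictly associative, so the same matrix can be read with
  respect to either grouping of the tensor factors.\<close>

definition kron_vec :: "complex vec \<Rightarrow> complex vec \<Rightarrow> complex vec" where
  "kron_vec v w =
     vec (dim_vec v * dim_vec w) (\<lambda>i. v $ (i div dim_vec w) * w $ (i mod dim_vec w))"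

definition kron_mat :: "complex mat \<Rightarrow> complex mat \<Rightarrow> complex mat" where
  "kron_mat A B =
     mat (dim_row A * dim_row B) (dim_col A * dim_col B)
       (\<lambda>(i, j). A $$ (i div dim_row B, j div dim_col B) * B $$ (i mod dim_row B, j mod dim_col B))"

text \<open>The operator \<open>|v\<rangle>\<langle>v|\<close>.\<close>

definition ketbra :: "complex vec \<Rightarrow> complex mat" where
  "ketbra v = mat (dim_vec v) (dim_vec v) (\<lambda>(i, j). v $ i * cnj (v $ j))"

definition unit_ket :: "nat \<Rightarrow> complex vec \<Rightarrow> bool" where
  "unit_ket d v \<longleftrightarrow> v \<in> carrier_vec d \<and> v \<bullet>c v = 1"

definition positive_semidefinite :: "nat \<Rightarrow> complex mat \<Rightarrow> bool" where
  "positive_semidefinite d A \<longleftrightarrow>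
     A \<in> carrier_mat d d \<and> mat_adjoint A = A \<and>
     (\<forall>v\<in>carrier_vec d. 0 \<le> Re ((A *\<^sub>v v) \<bullet>c v))"

section \<open>States\<close>

definition quantum_state :: "nat \<Rightarrow> complex mat \<Rightarrow> bool" where
  "quantum_state d \<rho> \<longleftrightarrow> positive_semidefinite d \<rho> \<and> mat_trace \<rho> = 1"

definition separable_state :: "nat \<Rightarrow> nat \<Rightarrow> complex mat \<Rightarrow> bool" where
  "separable_state dA dB \<rho> \<longleftrightarrow>
     (\<exists>(n::nat) (p::nat \<Rightarrow> real) \<sigma> \<tau>.
        (\<forall>k<n. 0 \<le> p k \<and> quantum_state dA (\<sigma> k) \<and> quantum_state dB (\<tau> k)) \<and>
        (\<Sum>k<n. p k) = 1 \<and>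
        \<rho> = mat_sum (dA * dB) (dA * dB)
              (\<lambda>k. complex_of_real (p k) \<cdot>\<^sub>m kron_mat (\<sigma> k) (\<tau> k)) {..<n})"

definition entangled_state :: "nat \<Rightarrow> nat \<Rightarrow> complex mat \<Rightarrow> bool" where
  "entangled_state dA dB \<rho> \<longleftrightarrow> quantum_state (dA * dB) \<rho> \<and> \<not> separable_state dA dB \<rho>"

definition informationally_complete :: "nat \<Rightarrow> 'i set \<Rightarrow> ('i \<Rightarrow> complex vec) \<Rightarrow> bool" where
  "informationally_complete d S \<phi> \<longleftrightarrow>
     (\<forall>X\<in>carrier_mat d d. \<exists>c. X = mat_sum d d (\<lambda>s. c s \<cdot>\<^sub>m ketbra (\<phi> s)) S)"

definition max_entangled :: "nat \<Rightarrow> complex vec" where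
  "max_entangled d =
     vec (d * d) (\<lambda>i. 1 / complex_of_real (sqrt (real d)) *
       (\<Sum>k<d. kron_vec (unit_vec d k) (unit_vec d k) $ i))"

section \<open>Correlations\<close>

text \<open>\<open>P a b v w\<close> stands for \<open>P(a, b | |v\<rangle>, |w\<rangle>)\<close>.\<close>

type_synonym correlation = "nat \<Rightarrow> nat \<Rightarrow> complex vec \<Rightarrow> complex vec \<Rightarrow> real"

text \<open>The two-outcome measurement consisting of the projection onto the maximally entangled
  state (outcome 1) and its complement (outcome 0).\<close>

definition max_entangled_effect :: "nat \<Rightarrow> nat \<Rightarrow> complex mat" where
  "max_entangled_effect d a =
     (if a = 1 then ketbra (max_entangled d) else 1\<^sub>m (d * d) - ketbra (max_entangled d))"

text \<open>The factors are ordered \<open>A' \<otimes> A \<otimes> B \<otimes> B'\<close>; the trace is real.\<close>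

definition quantum_correlation :: "nat \<Rightarrow> nat \<Rightarrow> complex mat \<Rightarrow> correlation" where
  "quantum_correlation dA dB \<rho> a b v w =
     Re (mat_trace (kron_mat (max_entangled_effect dA a) (max_entangled_effect dB b) *
                    kron_mat (kron_mat (ketbra v) \<rho>) (ketbra w)))"

subsection \<open>Local operations and classical communication\<close>

text \<open>The protocol for one value of the shared randomness is a tree. An inner node says who
  measures next and lists, for each outcome \<open>m\<close> announced, the Kraus operator \<open>K\<^sub>m\<close> and the
  continuation of the protocol. A node is the transcript so far, so the acting party, the
  measurement and the final outputs depend arbitrarily on it.\<close>

datatype locc_tree =
    Output nat nat
  | Alice "(complex mat \<times> locc_tree) list"
  | Bob "(complex mat \<times> locc_tree) list"

definition kraus_family :: "nat \<Rightarrow> complex mat list \<Rightarrow> bool" where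
  "kraus_family d Ks \<longleftrightarrow>
     (\<forall>K\<in>set Ks. dim_col K = d) \<and>
     mat_sum d d (\<lambda>m. mat_adjoint (Ks ! m) * Ks ! m) {..<length Ks} = 1\<^sub>m d"

text \<open>\<open>locc_valid n dA dB T\<close>: \<open>T\<close> is a protocol with at most \<open>n\<close> rounds and outputs in
  \<open>{0, 1}\<close> for parties whose current local dimensions are \<open>dA\<close> and \<open>dB\<close>. The output dimension
  of a measurement is arbitrary and may depend on the outcome.\<close>

inductive locc_valid :: "nat \<Rightarrow> nat \<Rightarrow> nat \<Rightarrow> locc_tree \<Rightarrow> bool" where
  Output: "a \<in> {0, 1} \<Longrightarrow> b \<in> {0, 1} \<Longrightarrow> locc_valid n dA dB (Output a b)"
| Alice: "kraus_family dA (map fst KTs) \<Longrightarrow>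
          (\<And>K T. (K, T) \<in> set KTs \<Longrightarrow> locc_valid n (dim_row K) dB T) \<Longrightarrow>
          locc_valid (Suc n) dA dB (Alice KTs)"
| Bob: "kraus_family dB (map fst KTs) \<Longrightarrow>
        (\<And>K T. (K, T) \<in> set KTs \<Longrightarrow> locc_valid n dA (dim_row K) T) \<Longrightarrow>
        locc_valid (Suc n) dA dB (Bob KTs)"

text \<open>\<open>locc_prob dA dB T a b \<chi>\<close> is the probability of the outputs \<open>(a, b)\<close> when \<open>T\<close> is run
  on the joint state \<open>\<chi>\<close>. Post-measurement states are left unnormalised, so that the squared
  norm at a leaf is the probability of the transcript leading to it.\<close>

fun locc_prob :: "nat \<Rightarrow> nat \<Rightarrow> locc_tree \<Rightarrow> nat \<Rightarrow> nat \<Rightarrow> complex vec \<Rightarrow> real" where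
  "locc_prob dA dB (Output a' b') a b \<chi> = (if a = a' \<and> b = b' then Re (\<chi> \<bullet>c \<chi>) else 0)"
| "locc_prob dA dB (Alice KTs) a b \<chi> =
     (\<Sum>(K, T)\<leftarrow>KTs. locc_prob (dim_row K) dB T a b (kron_mat K (1\<^sub>m dB) *\<^sub>v \<chi>))"
| "locc_prob dA dB (Bob KTs) a b \<chi> =
     (\<Sum>(K, T)\<leftarrow>KTs. locc_prob dA (dim_row K) T a b (kron_mat (1\<^sub>m dA) K *\<^sub>v \<chi>))"

text \<open>\<open>P\<close> is the correlation, on inputs from \<open>V\<close> and \<open>W\<close>, of a finite-round protocol that runs
  \<open>T l\<close> when the shared random variable has the value \<open>l\<close>, where \<open>l\<close> is distributed
  according to \<open>\<mu>\<close>.\<close>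

definition locc_protocol_correlation ::
  "nat \<Rightarrow> nat \<Rightarrow> complex vec set \<Rightarrow> complex vec set \<Rightarrow> 'l measure \<Rightarrow> ('l \<Rightarrow> locc_tree) \<Rightarrow> correlation \<Rightarrow> bool"
where
  "locc_protocol_correlation dA dB V W \<mu> T P \<longleftrightarrow>
     prob_space \<mu> \<and>
     (\<exists>n. \<forall>l\<in>space \<mu>. locc_valid n dA dB (T l)) \<and>
     (\<forall>a\<in>{0, 1}. \<forall>b\<in>{0, 1}. \<forall>v\<in>V. \<forall>w\<in>W.
        (\<lambda>l. locc_prob dA dB (T l) a b (kron_vec v w)) \<in> borel_measurable \<mu> \<and>
        P a b v w = (\<integral>l. locc_prob dA dB (T l) a b (kron_vec v w) \<partial>\<mu>))"

text \<open>The values of the shared random variable are taken in the type \<open>locc_tree\<close> because a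
  definition cannot quantify over types. By the lemma \<open>finite_round_locc_any_randomness\<close> this
  is no restriction: every probability space gives a correlation of this kind.\<close>

definition finite_round_locc ::
  "nat \<Rightarrow> nat \<Rightarrow> complex vec set \<Rightarrow> complex vec set \<Rightarrow> correlation \<Rightarrow> bool" where
  "finite_round_locc dA dB V W P \<longleftrightarrow>
     (\<exists>(\<mu> :: locc_tree measure) T. locc_protocol_correlation dA dB V W \<mu> T P)"

lemma finite_round_locc_any_randomness:
  fixes \<mu> :: "'l measure"
  assumes "locc_protocol_correlation dA dB V W \<mu> T P"
  shows "finite_round_locc dA dB V W P"
proof -
  interpret prob_space \<mu>
    using assms by (simp add: locc_protocol_correlation_def)
  define S where "S = {X. X \<subseteq> T ` space \<mu> \<and> T -` X \<inter> space \<mu> \<in> sets \<mu>}"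
  have alg: "sigma_algebra (T ` space \<mu>) S"
  proof (rule sigma_algebra_iff2[THEN iffD2], intro conjI ballI allI impI)
    show "S \<subseteq> Pow (T ` space \<mu>)" "{} \<in> S"
      by (auto simp: S_def)
    show "T ` space \<mu> - X \<in> S" if "X \<in> S" for X
    proof -
      have "T -` (T ` space \<mu> - X) \<inter> space \<mu> = space \<mu> - (T -` X \<inter> space \<mu>)"
        by auto
      then show ?thesis using that by (auto simp: S_def)
    qed
    show "\<Union> (range A) \<in> S" if "range A \<subseteq> S" for A :: "nat \<Rightarrow> _"
    proof -
      have "T -` \<Union> (range A) \<inter> space \<mu> = (\<Union>i. T -` A i \<inter> space \<mu>)"
        by auto
      moreover have "T -` A i \<inter> space \<mu> \<in> sets \<mu>" for i
        using that by (auto simp: S_def)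
      ultimately have "T -` \<Union> (range A) \<inter> space \<mu> \<in> sets \<mu>"
        by (metis sets.countable_UN image_subsetI)
      then show ?thesis using that unfolding S_def by blast
    qed
  qed
  define N where "N = distr \<mu> (measure_of (T ` space \<mu>) S (\<lambda>_. 0)) T"
  have spN: "space N = T ` space \<mu>" and setsN: "sets N = S"
    using alg by (auto simp: N_def sigma_algebra.space_measure_of_eq
        sigma_algebra.sets_measure_of_eq)
  have meas: "T \<in> measurable \<mu> (measure_of (T ` space \<mu>) S (\<lambda>_. 0))"
    using alg by (intro measurableI)
      (auto simp: sigma_algebra.space_measure_of_eq sigma_algebra.sets_measure_of_eq S_def)
  have "locc_protocol_correlation dA dB V W N (\<lambda>T. T) P"
    unfolding locc_protocol_correlation_def
  proof (intro conjI ballI)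
    show "prob_space N"
      unfolding N_def by (rule prob_space_distr[OF meas])
    show "\<exists>n. \<forall>t\<in>space N. locc_valid n dA dB t"
      using assms unfolding spN locc_protocol_correlation_def by fast
    fix a b :: nat and v w
    assume *: "a \<in> {0, 1}" "b \<in> {0, 1}" "v \<in> V" "w \<in> W"
    define f where "f t = locc_prob dA dB t a b (kron_vec v w)" for t
    have fT: "(\<lambda>l. f (T l)) \<in> borel_measurable \<mu>"
      and P: "P a b v w = (\<integral>l. f (T l) \<partial>\<mu>)"
      using assms * unfolding locc_protocol_correlation_def f_def by blast+
    have f: "f \<in> borel_measurable N"
    proof (rule measurableI)
      fix B :: "real set" assume "B \<in> sets borel"
      then have "(\<lambda>l. f (T l)) -` B \<inter> space \<mu> \<in> sets \<mu>"
        by (rule measurable_sets[OF fT])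
      moreover have "T -` (f -` B \<inter> space N) \<inter> space \<mu> = (\<lambda>l. f (T l)) -` B \<inter> space \<mu>"
        by (auto simp: spN)
      ultimately show "f -` B \<inter> space N \<in> sets N"
        by (auto simp: setsN S_def spN)
    qed auto
    then show "(\<lambda>t. locc_prob dA dB t a b (kron_vec v w)) \<in> borel_measurable N"
      by (simp add: f_def[abs_def])
    have "f \<in> borel_measurable (measure_of (T ` space \<mu>) S (\<lambda>_. 0))"
      using f by (simp add: N_def)
    then have "(\<integral>t. f t \<partial>N) = (\<integral>l. f (T l) \<partial>\<mu>)"
      unfolding N_def by (rule integral_distr[OF meas])
    then show "P a b v w = (\<integral>t. locc_prob dA dB t a b (kron_vec v w) \<partial>N)"
      using P by (simp add: f_def)
  qed
  then show ?thesis
    unfolding finite_round_locc_def by blast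
qed

definition locc_correlation ::
  "nat \<Rightarrow> nat \<Rightarrow> complex vec set \<Rightarrow> complex vec set \<Rightarrow> correlation \<Rightarrow> bool" where
  "locc_correlation dA dB V W P \<longleftrightarrow>
     finite_round_locc dA dB V W P \<or>
     (\<exists>Q. (\<forall>k::nat. finite_round_locc dA dB V W (Q k)) \<and>
          (\<forall>a\<in>{0, 1}. \<forall>b\<in>{0, 1}. \<forall>v\<in>V. \<forall>w\<in>W. (\<lambda>k. Q k a b v w) \<longlonglongrightarrow> P a b v w))"

end

theory Submission
  imports Defs
begin

text \<open>
  Write \<open>f X\<close> for the real vector with entries \<open>tr (X (\<phi>\<^sub>s\<phi>\<^sub>s\<^sup>*)\<^sup>T \<otimes> (\<psi>\<^sub>t\<psi>\<^sub>t\<^sup>*)\<^sup>T)\<close>. Projecting onto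
  maximally entangled states teleports the inputs onto \<open>\<rho>\<close>, so the quantum correlation is
  \<open>f \<rho> / (dA dB)\<close>. By informational completeness \<open>f\<close> is injective, so for entangled \<open>\<rho>\<close> the
  vector \<open>f \<rho>\<close> is outside the convex hull of the compact set of all \<open>f (aa\<^sup>* \<otimes> bb\<^sup>*)\<close>, and a
  hyperplane \<open>\<beta>\<close> through the origin separates the two: the normalisation \<open>tr X = 1\<close> is linear in
  \<open>f X\<close>, which turns the affine hyperplane into a linear one.
  A transcript of an LOCC protocol acts as a product Kraus operator \<open>A \<otimes> B\<close>, and its probability is a sum of terms \<open>|x \<bullet> \<phi>\<^sub>s|\<^sup>2 |y \<bullet> \<psi>\<^sub>t|\<^sup>2\<close> over rows \<open>x\<close> of \<open>A\<close> and \<open>y\<close> of \<open>B\<close>, on which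
  \<open>\<beta>\<close> is nonnegative.
\<close>

section \<open>Separation from a compact family in finite dimension\<close>

text \<open>Gaussian elimination, by induction on the coordinates: a vector that is nonzero at the
  new coordinate \<open>i\<close> serves as a pivot clearing \<open>i\<close> from all others, which
  are one fewer and are compared on one coordinate less.\<close>

lemma exists_linear_dependency:
  fixes v :: "'k \<Rightarrow> 'i \<Rightarrow> 'a :: field"
  assumes "finite I" "finite K" "card I < card K"
  shows "\<exists>u. (\<exists>k\<in>K. u k \<noteq> 0) \<and> (\<forall>i\<in>I. (\<Sum>k\<in>K. u k * v k i) = 0)"
  using assms
proof (induction I arbitrary: K v rule: finite_induct)
  case empty
  then have "K \<noteq> {}" by auto
  then show ?case by (intro exI[of _ "\<lambda>_. 1"]) auto
next
  case (insert i I)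
  show ?case
  proof (cases "\<forall>k\<in>K. v k i = 0")
    case True
    obtain u where "\<exists>k\<in>K. u k \<noteq> 0" "\<forall>j\<in>I. (\<Sum>k\<in>K. u k * v k j) = 0"
      using insert.IH[of K v] insert.prems insert.hyps by auto
    with True show ?thesis by (intro exI[of _ u]) auto
  next
    case False
    then obtain k0 where k0: "k0 \<in> K" "v k0 i \<noteq> 0" by blast
    define K' where "K' = K - {k0}"
    define v' where "v' k j = v k j - v k i / v k0 i * v k0 j" for k j
    have fK': "finite K'" and cK': "card I < card K'"
      using insert.prems insert.hyps k0 by (auto simp: K'_def)
    obtain u' where nz: "\<exists>k\<in>K'. u' k \<noteq> 0" and z: "\<forall>j\<in>I. (\<Sum>k\<in>K'. u' k * v' k j) = 0"
      using insert.IH[OF fK' cK', of v'] by blast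
    \<comment> \<open>The coefficient of the pivot \<open>k0\<close> collects what the elimination
      subtracted, so that the combination of the original vectors equals that of the reduced
      ones.\<close>
    define u where "u = u'(k0 := - (\<Sum>k\<in>K'. u' k * v k i / v k0 i))"
    have split: "(\<Sum>k\<in>K. u k * v k j) = (\<Sum>k\<in>K'. u' k * v' k j)" for j
    proof -
      have "(\<Sum>k\<in>K. u k * v k j) = u k0 * v k0 j + (\<Sum>k\<in>K'. u k * v k j)"
        using k0 insert.prems by (simp add: K'_def sum.remove)
      also have "(\<Sum>k\<in>K'. u k * v k j) = (\<Sum>k\<in>K'. u' k * v k j)"
        by (rule sum.cong) (auto simp: u_def K'_def)
      also have "u k0 * v k0 j = - (\<Sum>k\<in>K'. u' k * (v k i / v k0 i * v k0 j))"
        by (simp add: u_def sum_distrib_right mult.assoc)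
      also have "- (\<Sum>k\<in>K'. u' k * (v k i / v k0 i * v k0 j)) + (\<Sum>k\<in>K'. u' k * v k j)
          = (\<Sum>k\<in>K'. u' k * v' k j)"
        by (simp only: v'_def right_diff_distrib sum_subtractf) simp
      finally show ?thesis .
    qed
    have "\<exists>k\<in>K. u k \<noteq> 0"
      using nz by (auto simp: u_def K'_def)
    moreover have "(\<Sum>k\<in>K. u k * v k i) = 0"
      unfolding split using k0 by (simp add: v'_def)
    ultimately show ?thesis
      using z split by (intro exI[of _ u]) auto
  qed
qed

text \<open>Since \<open>w\<close> is 1 on all points, linear dependencies among them are affine ones.\<close>

lemma convex_combination_drop_point:
  fixes y :: "nat \<Rightarrow> 'i \<Rightarrow> real"
  assumes "finite I"
    and w: "\<And>k. k \<le> card I \<Longrightarrow> (\<Sum>i\<in>I. w i * y k i) = 1"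
    and c: "\<And>k. k \<le> card I \<Longrightarrow> 0 \<le> c k" "(\<Sum>k\<le>card I. c k) = 1"
  obtains k0 c' where "k0 \<le> card I" "\<And>k. k \<le> card I \<Longrightarrow> 0 \<le> c' k" "c' k0 = 0"
    "(\<Sum>k\<le>card I. c' k) = 1"
    "\<And>i. i \<in> I \<Longrightarrow> (\<Sum>k\<le>card I. c' k * y k i) = (\<Sum>k\<le>card I. c k * y k i)"
proof -
  let ?K = "{..card I}"
  obtain u where u: "\<exists>k\<in>?K. u k \<noteq> 0" "\<And>i. i \<in> I \<Longrightarrow> (\<Sum>k\<in>?K. u k * y k i) = 0"
    using exists_linear_dependency[of I ?K y] \<open>finite I\<close> by auto
  have u0: "(\<Sum>k\<in>?K. u k) = 0"
  proof -
    have "(\<Sum>k\<in>?K. u k) = (\<Sum>k\<in>?K. u k * (\<Sum>i\<in>I. w i * y k i))"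
      using w by simp
    also have "\<dots> = (\<Sum>i\<in>I. w i * (\<Sum>k\<in>?K. u k * y k i))"
      unfolding sum_distrib_left by (subst sum.swap) (simp add: algebra_simps)
    finally show ?thesis using u by simp
  qed
  \<comment> \<open>Only these indices lose weight when a nonnegative multiple of \<open>u\<close>
    is subtracted. There are some, since the \<open>u k\<close> sum to 0 without all being
    0.\<close>
  define N where "N = {k\<in>?K. u k > 0}"
  have "N \<noteq> {}"
  proof
    assume "N = {}"
    then have "\<forall>k\<in>?K. u k \<le> 0" by (force simp: N_def)
    then have "\<forall>k\<in>?K. - u k = 0"
      using u0 by (subst sum_nonneg_eq_0_iff[symmetric]) (auto simp: sum_negf)
    with u(1) show False by auto
  qed
  moreover have "finite N" by (simp add: N_def)
  ultimately obtain k0 where k0: "k0 \<in> N" "\<And>k. k \<in> N \<Longrightarrow> c k0 / u k0 \<le> c k / u k"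
    using ex_is_arg_min_if_finite[of N "\<lambda>k. c k / u k"] by (auto simp: is_arg_min_linorder)
  \<comment> \<open>The largest step for which all weights \<open>c k - t * u k\<close> stay
    nonnegative; at the minimising index \<open>k0\<close> the weight reaches 0.\<close>
  define t where "t = c k0 / u k0"
  have "t \<ge> 0" using k0 c by (auto simp: t_def N_def)
  define c' where "c' k = c k - t * u k" for k
  show thesis
  proof (rule that)
    show "k0 \<le> card I" "c' k0 = 0"
      using k0 by (auto simp: N_def c'_def t_def)
    show "0 \<le> c' k" if k: "k \<le> card I" for k
    proof (cases "u k > 0")
      case True
      then have "t \<le> c k / u k" using k0 k by (auto simp: N_def t_def)
      with True show ?thesis by (simp add: c'_def field_simps)
    next
      case False
      then have "t * u k \<le> 0" using \<open>t \<ge> 0\<close> by (simp add: mult_nonneg_nonpos)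
      then show ?thesis using c(1)[OF k] by (simp add: c'_def)
    qed
    show "(\<Sum>k\<le>card I. c' k) = 1"
      using c u0 by (simp add: c'_def sum_subtractf flip: sum_distrib_left)
    show "(\<Sum>k\<le>card I. c' k * y k i) = (\<Sum>k\<le>card I. c k * y k i)" if "i \<in> I" for i
      using u(2)[OF that]
      by (simp add: c'_def left_diff_distrib sum_subtractf mult.assoc flip: sum_distrib_left)
  qed
qed

section \<open>Closest points and separating hyperplanes\<close>

lemma compact_Pi_UNIV:
  fixes S :: "'a :: topological_space set"
  assumes "compact S"
  shows "compact {f :: 'i \<Rightarrow> 'a. \<forall>i. f i \<in> S}"
proof -
  \<comment> \<open>Tychonoff's theorem; the product topology is the topology of the function
    type.\<close>
  have "compactin (product_topology (\<lambda>_. euclidean) UNIV) (PiE UNIV (\<lambda>_::'i. S))"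
    using assms by (subst compactin_PiE) auto
  then show ?thesis
    by (simp add: euclidean_product_topology PiE_UNIV_domain Pi_def)
qed

text \<open>With the number \<open>n\<close> of points fixed, weights and points range over a
  compact product, on which the squared distance to \<open>p\<close> is continuous.\<close>

lemma convex_combinations_attain_min_distance:
  fixes g :: "'x :: topological_space \<Rightarrow> 'i \<Rightarrow> real" and p :: "'i \<Rightarrow> real" and n :: nat
  assumes "compact X" "X \<noteq> {}" "0 < n"
    and cont: "\<And>i. i \<in> I \<Longrightarrow> continuous_on X (\<lambda>x. g x i)"
  defines "dst \<equiv> \<lambda>c x. \<Sum>i\<in>I. ((\<Sum>k<n. c k * g (x k) i) - p i)\<^sup>2"
  obtains c x where "\<And>k. 0 \<le> c k" "(\<Sum>k<n. c k) = 1" "\<And>k. x k \<in> X"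
    "\<And>(c' :: nat \<Rightarrow> real) x'. (\<And>k. k < n \<Longrightarrow> 0 \<le> c' k) \<Longrightarrow> (\<Sum>k<n. c' k) = 1 \<Longrightarrow> (\<And>k. k < n \<Longrightarrow> x' k \<in> X) \<Longrightarrow>
       dst c x \<le> dst c' x'"
proof -
  \<comment> \<open>Weights are bounded at every index, not only below \<open>n\<close>, so that
    they form a closed subset of a compact product of intervals. The values from \<open>n\<close> on
    do not enter \<open>dst\<close>.\<close>
  define C where "C = {c :: nat \<Rightarrow> real. \<forall>k. c k \<in> {0..1}} \<inter> {c :: nat \<Rightarrow> real. (\<Sum>k<n. c k) = 1}"
  define Y where "Y = {x :: nat \<Rightarrow> 'x. \<forall>k. x k \<in> X}"
  have "compact C"
    unfolding C_def
    by (intro compact_Int_closed compact_Pi_UNIV closed_Collect_eq continuous_intros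
        continuous_on_product_coordinates) auto
  moreover have "compact Y"
    unfolding Y_def by (rule compact_Pi_UNIV) fact
  ultimately have "compact (C \<times> Y)" by (rule compact_Times)
  moreover obtain x0 where "x0 \<in> X" using \<open>X \<noteq> {}\<close> by blast
  then have "((\<lambda>k. if k = 0 then 1 else 0), \<lambda>_. x0) \<in> C \<times> Y"
    using \<open>0 < n\<close> by (auto simp: C_def Y_def)
  then have "C \<times> Y \<noteq> {}" by blast
  moreover have "continuous_on (C \<times> Y) (\<lambda>(c, x). dst c x)"
  proof -
    have fst: "continuous_on (C \<times> Y) (\<lambda>z. fst z k)" for k
      by (rule continuous_on_compose2[OF continuous_on_product_coordinates continuous_on_fst])
        (auto intro: continuous_intros)
    have snd: "continuous_on (C \<times> Y) (\<lambda>z. snd z k)" for k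
      by (rule continuous_on_compose2[OF continuous_on_product_coordinates continuous_on_snd])
        (auto intro: continuous_intros)
    have "continuous_on (C \<times> Y) (\<lambda>z. g (snd z k) i)" if "i \<in> I" for k i
      by (rule continuous_on_compose2[OF cont[OF that] snd]) (auto simp: Y_def)
    then show ?thesis
      unfolding dst_def case_prod_unfold
      by (intro continuous_on_sum continuous_on_power continuous_on_diff continuous_on_mult
          continuous_on_const fst)
  qed
  ultimately have "\<exists>z\<in>C \<times> Y. \<forall>z'\<in>C \<times> Y. (\<lambda>(c, x). dst c x) z \<le> (\<lambda>(c, x). dst c x) z'"
    by (rule continuous_attains_inf)
  then obtain z where z: "z \<in> C \<times> Y"
    "\<forall>z'\<in>C \<times> Y. (\<lambda>(c, x). dst c x) z \<le> (\<lambda>(c, x). dst c x) z'"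
    by (rule bexE)
  obtain c x where "z = (c, x)" by (cases z)
  with z have cx: "(c, x) \<in> C \<times> Y" by simp
  have min: "dst c x \<le> dst c' x'" if "(c', x') \<in> C \<times> Y" for c' x'
    using z(2)[rule_format, OF that] \<open>z = (c, x)\<close> by simp
  show thesis
  proof (rule that[of c x])
    show "0 \<le> c k" "(\<Sum>k<n. c k) = 1" "x k \<in> X" for k
      using cx by (auto simp: C_def Y_def)
    fix c' :: "nat \<Rightarrow> real" and x'
    assume c': "\<And>k. k < n \<Longrightarrow> 0 \<le> c' k" "(\<Sum>k<n. c' k) = 1"
      and x': "\<And>k. k < n \<Longrightarrow> x' k \<in> X"
    \<comment> \<open>A competitor is constrained only below \<open>n\<close>; the values 0 and
      \<open>x0\<close> elsewhere put it into the compact set without changing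
      \<open>dst\<close>.\<close>
    define c'' where "c'' k = (if k < n then c' k else 0)" for k
    define x'' where "x'' k = (if k < n then x' k else x0)" for k
    have "c' k \<le> 1" if "k < n" for k
      using member_le_sum[of k "{..<n}" c'] c' that by auto
    then have "(c'', x'') \<in> C \<times> Y"
      using c' x' \<open>x0 \<in> X\<close> by (auto simp: C_def Y_def c''_def x''_def)
    then have "dst c x \<le> dst c'' x''"
      by (rule min)
    also have "\<dots> = dst c' x'"
      by (simp add: dst_def c''_def x''_def)
    finally show "dst c x \<le> dst c' x'" .
  qed
qed

text \<open>The first-order condition at a closest point.\<close>

lemma min_distance_first_order:
  fixes q :: "'i \<Rightarrow> real"
  assumes min: "\<And>t. 0 < t \<Longrightarrow> t < 1 \<Longrightarrow>
      (\<Sum>i\<in>I. (q i - p i)\<^sup>2) \<le> (\<Sum>i\<in>I. ((1 - t) * q i + t * h i - p i)\<^sup>2)"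
  shows "(\<Sum>i\<in>I. (q i - p i) * q i) \<le> (\<Sum>i\<in>I. (q i - p i) * h i)"
proof (rule ccontr)
  assume neg: "\<not> ?thesis"
  define D where "D = (\<Sum>i\<in>I. (q i - p i) * (h i - q i))"
  define E where "E = (\<Sum>i\<in>I. (h i - q i)\<^sup>2)"
  have "D < 0" using neg by (simp add: D_def right_diff_distrib sum_subtractf)
  have "E \<ge> 0" by (simp add: E_def sum_nonneg)
  \<comment> \<open>The bound 1/2 keeps \<open>t\<close> below 1; the other gives
    \<open>t * E \<le> - D\<close>, so that the change \<open>t * (2 * D + t * E)\<close> is
    negative. The summand 1 in \<open>E + 1\<close> avoids division by 0.\<close>
  define t where "t = min (1/2) (- D / (E + 1))"
  have t: "0 < t" "t < 1" using \<open>D < 0\<close> \<open>E \<ge> 0\<close> by (auto simp: t_def intro: divide_neg_pos)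
  have "(\<Sum>i\<in>I. ((1 - t) * q i + t * h i - p i)\<^sup>2)
      = (\<Sum>i\<in>I. (q i - p i)\<^sup>2 + t * (2 * ((q i - p i) * (h i - q i)) + t * (h i - q i)\<^sup>2))"
    by (rule sum.cong) (auto simp: power2_eq_square algebra_simps)
  also have "\<dots> = (\<Sum>i\<in>I. (q i - p i)\<^sup>2) + t * (2 * D + t * E)"
    by (simp add: sum.distrib D_def E_def flip: sum_distrib_left)
  finally have "0 \<le> t * (2 * D + t * E)" using min[OF t] by simp
  then have "0 \<le> 2 * D + t * E" using t by (simp add: zero_le_mult_iff)
  moreover have "t * E \<le> t * (E + 1)" using t by simp
  moreover have "t * (E + 1) \<le> - D"
    using \<open>E \<ge> 0\<close> by (subst pos_le_divide_eq[symmetric]) (auto simp: t_def)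
  ultimately show False using \<open>D < 0\<close> by linarith
qed

text \<open>Let \<open>q\<close> be closest to \<open>p\<close> among combinations of
  \<open>card I\<close> points. The segment from \<open>q\<close> towards \<open>g h\<close> needs
  one point more, but \<open>convex_combination_drop_point\<close> brings it back to
  \<open>card I\<close> points, so \<open>q\<close> is also closest on this segment. Hence
  \<open>q - p\<close> is the normal of a separating hyperplane.\<close>

lemma separation_from_compact_family:
  fixes g :: "'x :: topological_space \<Rightarrow> 'i \<Rightarrow> real" and p :: "'i \<Rightarrow> real"
  assumes "finite I" "I \<noteq> {}" "compact X" "X \<noteq> {}"
    and cont: "\<And>i. i \<in> I \<Longrightarrow> continuous_on X (\<lambda>x. g x i)"
    and wg: "\<And>x. x \<in> X \<Longrightarrow> (\<Sum>i\<in>I. w i * g x i) = 1"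
    and wp: "(\<Sum>i\<in>I. w i * p i) = 1"
    and notin: "\<And>(n :: nat) c x. (\<And>k. 0 \<le> c k) \<Longrightarrow> (\<Sum>k<n. c k) = 1 \<Longrightarrow> (\<And>k. x k \<in> X) \<Longrightarrow>
       \<exists>i\<in>I. p i \<noteq> (\<Sum>k<n. c k * g (x k) i)"
  obtains \<beta> where "\<And>x. x \<in> X \<Longrightarrow> 0 \<le> (\<Sum>i\<in>I. \<beta> i * g x i)" "(\<Sum>i\<in>I. \<beta> i * p i) < 0"
proof -
  let ?n = "card I"
  have "0 < ?n" using assms by (simp add: card_gt_0_iff)
  obtain c x where c: "\<And>k. 0 \<le> c k" "(\<Sum>k<?n. c k) = 1" and x: "\<And>k. x k \<in> X"
    and min: "\<And>(c' :: nat \<Rightarrow> real) x'. (\<And>k. k < ?n \<Longrightarrow> 0 \<le> c' k) \<Longrightarrow> (\<Sum>k<?n. c' k) = 1 \<Longrightarrow>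
       (\<And>k. k < ?n \<Longrightarrow> x' k \<in> X) \<Longrightarrow>
       (\<Sum>i\<in>I. ((\<Sum>k<?n. c k * g (x k) i) - p i)\<^sup>2) \<le> (\<Sum>i\<in>I. ((\<Sum>k<?n. c' k * g (x' k) i) - p i)\<^sup>2)"
    using convex_combinations_attain_min_distance[where g = g and p = p, OF \<open>compact X\<close> \<open>X \<noteq> {}\<close> \<open>0 < ?n\<close> cont]
    by blast
  define q where "q i = (\<Sum>k<?n. c k * g (x k) i)" for i
  define b where "b i = q i - p i" for i
  define r where "r = (\<Sum>i\<in>I. b i * q i)"
  have first_order: "r \<le> (\<Sum>i\<in>I. b i * g h i)" if h: "h \<in> X" for h
    unfolding r_def b_def
  proof (rule min_distance_first_order)
    fix t :: real assume t: "0 < t" "t < 1"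
    \<comment> \<open>Index \<open>?n\<close> holds the additional point \<open>h\<close> with
      weight \<open>t\<close>; the old weights shrink by the factor \<open>1 - t\<close>.\<close>
    define c1 where "c1 k = (if k < ?n then (1 - t) * c k else t)" for k
    define x1 where "x1 k = (if k < ?n then x k else h)" for k
    have x1: "x1 k \<in> X" for k using x h by (simp add: x1_def)
    have sum1: "(\<Sum>k\<le>?n. c1 k * f (x1 k)) = (1 - t) * (\<Sum>k<?n. c k * f (x k)) + t * f h"
      for f :: "'x \<Rightarrow> real"
      by (simp add: c1_def x1_def lessThan_Suc_atMost[symmetric] sum_distrib_left mult.assoc)
    obtain k0 c2 where k0: "k0 \<le> ?n" and c2: "\<And>k. k \<le> ?n \<Longrightarrow> 0 \<le> c2 k" "c2 k0 = 0"
      "(\<Sum>k\<le>?n. c2 k) = 1"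
      and eq: "\<And>i. i \<in> I \<Longrightarrow> (\<Sum>k\<le>?n. c2 k * g (x1 k) i) = (\<Sum>k\<le>?n. c1 k * g (x1 k) i)"
    proof (rule convex_combination_drop_point[of I w "\<lambda>k. g (x1 k)" c1])
      show "finite I" by fact
      show "(\<Sum>i\<in>I. w i * g (x1 k) i) = 1" for k using wg x1 by blast
      show "0 \<le> c1 k" for k using c t by (simp add: c1_def)
      show "(\<Sum>k\<le>?n. c1 k) = 1" using sum1[of "\<lambda>_. 1"] c by simp
    qed blast
    \<comment> \<open>Exchanging the index \<open>k0\<close> of weight 0 with the last index
      \<open>?n\<close> leaves a combination over \<open>{..<?n}\<close>, to which minimality
      applies.\<close>
    have bij: "(\<Sum>k\<le>?n. c2 k * f (x1 k)) = (\<Sum>k<?n. c2 (Transposition.transpose k0 ?n k) * f (x1 (Transposition.transpose k0 ?n k)))"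
      for f :: "'x \<Rightarrow> real"
    proof -
      have "(\<Sum>k\<le>?n. c2 k * f (x1 k)) = (\<Sum>k\<le>?n. c2 (Transposition.transpose k0 ?n k) * f (x1 (Transposition.transpose k0 ?n k)))"
        using k0
        by (intro sum.reindex_bij_witness[of _ "Transposition.transpose k0 ?n" "Transposition.transpose k0 ?n"])
          (auto simp: Transposition.transpose_def)
      then show ?thesis
        by (simp add: lessThan_Suc_atMost[symmetric] c2)
    qed
    have "(\<Sum>i\<in>I. (q i - p i)\<^sup>2)
      \<le> (\<Sum>i\<in>I. ((\<Sum>k<?n. c2 (Transposition.transpose k0 ?n k) * g (x1 (Transposition.transpose k0 ?n k)) i) - p i)\<^sup>2)"
      unfolding q_def
    proof (rule min)
      show "0 \<le> c2 (Transposition.transpose k0 ?n k)" if "k < ?n" for k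
        using c2 k0 that by (auto simp: Transposition.transpose_def)
      show "(\<Sum>k<?n. c2 (Transposition.transpose k0 ?n k)) = 1"
        using bij[of "\<lambda>_. 1"] c2 by simp
    qed (rule x1)
    also have "\<dots> = (\<Sum>i\<in>I. ((1 - t) * q i + t * g h i - p i)\<^sup>2)"
    proof (rule sum.cong[OF refl])
      fix i assume "i \<in> I"
      show "((\<Sum>k<?n. c2 (Transposition.transpose k0 ?n k) * g (x1 (Transposition.transpose k0 ?n k)) i) - p i)\<^sup>2
        = ((1 - t) * q i + t * g h i - p i)\<^sup>2"
        using bij[of "\<lambda>x. g x i"] eq[OF \<open>i \<in> I\<close>] sum1[of "\<lambda>x. g x i"] by (simp add: q_def)
    qed
    finally show "(\<Sum>i\<in>I. (q i - p i)\<^sup>2) \<le> (\<Sum>i\<in>I. ((1 - t) * q i + t * g h i - p i)\<^sup>2)" .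
  qed
  \<comment> \<open>As \<open>p\<close> is no convex combination, it differs from \<open>q\<close>;
    this makes the separation strict.\<close>
  obtain i0 where "i0 \<in> I" "b i0 \<noteq> 0"
    using notin[of c ?n x] c x by (auto simp: b_def q_def)
  then have "0 < (\<Sum>i\<in>I. b i * b i)"
    using \<open>finite I\<close> by (intro sum_pos2[of I i0]) (auto simp: zero_less_mult_iff)
  also have "(\<Sum>i\<in>I. b i * b i) = r - (\<Sum>i\<in>I. b i * p i)"
    unfolding r_def sum_subtractf[symmetric] by (simp add: b_def right_diff_distrib)
  finally have bp: "(\<Sum>i\<in>I. b i * p i) < r" by simp
  \<comment> \<open>The functional \<open>w\<close> is 1 on \<open>p\<close> and on all points of
    the family, so subtracting \<open>r * w\<close> moves the hyperplane from level \<open>r\<close>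
    to level 0.\<close>
  define \<beta> where "\<beta> i = b i - r * w i" for i
  have \<beta>: "(\<Sum>i\<in>I. \<beta> i * f i) = (\<Sum>i\<in>I. b i * f i) - r * (\<Sum>i\<in>I. w i * f i)" for f
    by (simp add: \<beta>_def left_diff_distrib sum_subtractf sum_distrib_left mult.assoc)
  show thesis
  proof (rule that[of \<beta>])
    show "0 \<le> (\<Sum>i\<in>I. \<beta> i * g h i)" if "h \<in> X" for h
      using first_order[OF that] wg[OF that] by (simp add: \<beta>)
    show "(\<Sum>i\<in>I. \<beta> i * p i) < 0"
      using bp wp by (simp add: \<beta>)
  qed
qed

section \<open>Tensor products\<close>

text \<open>Every index below \<open>m * n\<close> is uniquely \<open>i * n + j\<close>: the
  lexicographic numbering of a product basis.\<close>

lemma sum_lessThan_times: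
  fixes m n :: nat
  shows "(\<Sum>x<m * n. f x) = (\<Sum>i<m. \<Sum>j<n. f (i * n + j))"
proof -
  have "sum f {i * n..<i * n + n} = (\<Sum>j<n. f (i * n + j))" for i
    using sum.shift_bounds_nat_ivl[of f 0 "i * n" n] by (simp add: atLeast0LessThan add.commute)
  then show ?thesis
    by (simp flip: sum.nat_group)
qed

lemma mult_add_less_mult:
  fixes i j m n :: nat
  assumes "i < m" "j < n"
  shows "i * n + j < m * n"
proof -
  have "i * n + j < Suc i * n" using assms by simp
  also have "\<dots> \<le> m * n" using assms by (intro mult_le_mono1) simp
  finally show ?thesis .
qed

lemma mult_add_div_mod_less:
  fixes i j n :: nat
  assumes "j < n"
  shows "(i * n + j) div n = i" "(i * n + j) mod n = j"
  using assms by auto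

lemma Re_cscalar_prod_self: "Re (v \<bullet>c v) = (\<Sum>i<dim_vec v. (cmod (v $ i))\<^sup>2)"
  by (simp add: scalar_prod_def atLeast0LessThan cmod_power2 sum.distrib flip: power2_eq_square)

lemma dim_kron_vec [simp]: "dim_vec (kron_vec v w) = dim_vec v * dim_vec w"
  by (simp add: kron_vec_def)

lemma index_kron_vec:
  "i < dim_vec v \<Longrightarrow> j < dim_vec w \<Longrightarrow> kron_vec v w $ (i * dim_vec w + j) = v $ i * w $ j"
  by (simp add: kron_vec_def mult_add_less_mult mult_add_div_mod_less)

lemma dim_kron_mat [simp]:
  "dim_row (kron_mat A B) = dim_row A * dim_row B"
  "dim_col (kron_mat A B) = dim_col A * dim_col B"
  by (simp_all add: kron_mat_def)

lemma index_kron_mat: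
  "i < dim_row A \<Longrightarrow> j < dim_row B \<Longrightarrow> k < dim_col A \<Longrightarrow> l < dim_col B \<Longrightarrow>
    kron_mat A B $$ (i * dim_row B + j, k * dim_col B + l) = A $$ (i, k) * B $$ (j, l)"
  by (simp add: kron_mat_def mult_add_less_mult mult_add_div_mod_less)

lemma dim_ketbra [simp]: "dim_row (ketbra v) = dim_vec v" "dim_col (ketbra v) = dim_vec v"
  by (simp_all add: ketbra_def)

lemma index_ketbra [simp]:
  "i < dim_vec v \<Longrightarrow> j < dim_vec v \<Longrightarrow> ketbra v $$ (i, j) = v $ i * cnj (v $ j)"
  by (simp add: ketbra_def)

lemma kron_mat_mult_kron_vec:
  assumes "dim_col A = dim_vec v" "dim_col B = dim_vec w"
  shows "kron_mat A B *\<^sub>v kron_vec v w = kron_vec (A *\<^sub>v v) (B *\<^sub>v w)"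
proof (rule eq_vecI)
  fix x assume "x < dim_vec (kron_vec (A *\<^sub>v v) (B *\<^sub>v w))"
  then have x: "x < dim_row A * dim_row B" by simp
  define i j where "i = x div dim_row B" and "j = x mod dim_row B"
  have ij: "i < dim_row A" "j < dim_row B" "x = i * dim_row B + j"
    using x by (auto simp: i_def j_def less_mult_imp_div_less intro!: mod_less_divisor gr0I)
  have "(kron_mat A B *\<^sub>v kron_vec v w) $ x
      = (\<Sum>y<dim_vec v * dim_vec w. kron_mat A B $$ (x, y) * kron_vec v w $ y)"
    using x assms by (simp add: scalar_prod_def atLeast0LessThan)
  also have "\<dots> = (\<Sum>k<dim_vec v. \<Sum>l<dim_vec w. (A $$ (i, k) * v $ k) * (B $$ (j, l) * w $ l))"
    unfolding sum_lessThan_times using ij assms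
    by (intro sum.cong refl) (simp add: index_kron_vec index_kron_mat[of _ A _ B, simplified assms])
  also have "\<dots> = (A *\<^sub>v v) $ i * (B *\<^sub>v w) $ j"
    using ij assms by (simp add: scalar_prod_def atLeast0LessThan sum_product)
  also have "\<dots> = kron_vec (A *\<^sub>v v) (B *\<^sub>v w) $ x"
    using index_kron_vec[of i "A *\<^sub>v v" j "B *\<^sub>v w"] ij by simp
  finally show "(kron_mat A B *\<^sub>v kron_vec v w) $ x = kron_vec (A *\<^sub>v v) (B *\<^sub>v w) $ x" .
qed simp

lemma Re_cscalar_prod_kron_vec:
  "Re (kron_vec v w \<bullet>c kron_vec v w) = Re (v \<bullet>c v) * Re (w \<bullet>c w)"
  unfolding Re_cscalar_prod_self dim_kron_vec sum_lessThan_times sum_product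
  by (intro sum.cong refl) (simp add: index_kron_vec norm_mult power_mult_distrib)

lemma dim_mat_adjoint [simp]:
  "dim_row (mat_adjoint A) = dim_col A" "dim_col (mat_adjoint A) = dim_row A"
  by (simp_all add: mat_adjoint_def)

lemma index_mat_adjoint:
  "i < dim_col A \<Longrightarrow> j < dim_row A \<Longrightarrow> mat_adjoint A $$ (i, j) = conjugate (A $$ (j, i))"
  by (simp add: mat_adjoint_def mat_of_rows_def)

section \<open>LOCC protocols\<close>

text \<open>Expand the squared norms into entries and apply the completeness relation to the sum
  over outcomes. In physical terms, a measurement preserves total probability.\<close>

lemma kraus_family_norm:
  assumes "kraus_family d Ks" and v: "v \<in> carrier_vec d"
  shows "(\<Sum>K\<leftarrow>Ks. Re ((K *\<^sub>v v) \<bullet>c (K *\<^sub>v v))) = Re (v \<bullet>c v)"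
proof -
  have dim: "dim_col (Ks ! m) = d" if "m < length Ks" for m
    using assms that by (auto simp: kraus_family_def)
  have dv: "dim_vec v = d" using v by simp
  have one: "(\<Sum>m<length Ks. \<Sum>r<dim_row (Ks ! m). cnj (Ks ! m $$ (r, i)) * Ks ! m $$ (r, j))
      = (if i = j then 1 else 0)" if "i < d" "j < d" for i j
  proof -
    have "(\<Sum>m<length Ks. \<Sum>r<dim_row (Ks ! m). cnj (Ks ! m $$ (r, i)) * Ks ! m $$ (r, j))
      = mat_sum d d (\<lambda>m. mat_adjoint (Ks ! m) * Ks ! m) {..<length Ks} $$ (i, j)"
      using that dim by (auto simp: mat_sum_def scalar_prod_def atLeast0LessThan index_mat_adjoint
          intro!: sum.cong)
    then show ?thesis using assms that by (simp add: kraus_family_def)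
  qed
  have "complex_of_real (\<Sum>K\<leftarrow>Ks. Re ((K *\<^sub>v v) \<bullet>c (K *\<^sub>v v)))
      = (\<Sum>m<length Ks. complex_of_real (Re ((Ks ! m *\<^sub>v v) \<bullet>c (Ks ! m *\<^sub>v v))))"
    by (simp add: sum_list_sum_nth atLeast0LessThan)
  also have "\<dots> = (\<Sum>m<length Ks. \<Sum>r<dim_row (Ks ! m). \<Sum>i<d. \<Sum>j<d.
      cnj (v $ i) * v $ j * (cnj (Ks ! m $$ (r, i)) * Ks ! m $$ (r, j)))"
  proof (intro sum.cong refl)
    fix m assume "m \<in> {..<length Ks}"
    then have d: "dim_col (Ks ! m) = d" using dim by simp
    show "complex_of_real (Re ((Ks ! m *\<^sub>v v) \<bullet>c (Ks ! m *\<^sub>v v))) = (\<Sum>r<dim_row (Ks ! m). \<Sum>i<d. \<Sum>j<d.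
      cnj (v $ i) * v $ j * (cnj (Ks ! m $$ (r, i)) * Ks ! m $$ (r, j)))"
    proof -
      have "complex_of_real (Re ((Ks ! m *\<^sub>v v) \<bullet>c (Ks ! m *\<^sub>v v)))
        = (\<Sum>r<dim_row (Ks ! m). cnj ((Ks ! m *\<^sub>v v) $ r) * (Ks ! m *\<^sub>v v) $ r)"
        by (simp only: Re_cscalar_prod_self complex_norm_square of_real_sum dim_mult_mat_vec mult.commute)
      also have "\<dots> = (\<Sum>r<dim_row (Ks ! m). \<Sum>i<d. \<Sum>j<d.
          cnj (v $ i) * v $ j * (cnj (Ks ! m $$ (r, i)) * Ks ! m $$ (r, j)))"
        using d dv by (intro sum.cong refl)
          (simp add: scalar_prod_def atLeast0LessThan cnj_sum, simp only: sum_product, simp add: mult_ac)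
      finally show ?thesis .
    qed
  qed
  also have "\<dots> = (\<Sum>i<d. \<Sum>j<d. cnj (v $ i) * v $ j *
      (\<Sum>m<length Ks. \<Sum>r<dim_row (Ks ! m). cnj (Ks ! m $$ (r, i)) * Ks ! m $$ (r, j)))"
  proof -
    have "(\<Sum>m<length Ks. \<Sum>r<dim_row (Ks ! m). \<Sum>i<d. \<Sum>j<d. f m r i j)
      = (\<Sum>i<d. \<Sum>j<d. \<Sum>m<length Ks. \<Sum>r<dim_row (Ks ! m). f m r i j)" for f :: "_ \<Rightarrow> _ \<Rightarrow> _ \<Rightarrow> _ \<Rightarrow> complex"
    proof -
      have "(\<Sum>m<length Ks. \<Sum>r<dim_row (Ks ! m). \<Sum>i<d. \<Sum>j<d. f m r i j)
        = (\<Sum>m<length Ks. \<Sum>i<d. \<Sum>j<d. \<Sum>r<dim_row (Ks ! m). f m r i j)"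
        by (subst sum.swap, rule sum.cong[OF refl], rule sum.cong[OF refl], rule sum.swap)
      also have "\<dots> = (\<Sum>i<d. \<Sum>j<d. \<Sum>m<length Ks. \<Sum>r<dim_row (Ks ! m). f m r i j)"
        by (subst sum.swap, rule sum.cong[OF refl], rule sum.swap)
      finally show ?thesis .
    qed
    then show ?thesis by (simp add: sum_distrib_left)
  qed
  also have "\<dots> = (\<Sum>i<d. \<Sum>j<d. if i = j then cnj (v $ i) * v $ j else 0)"
    using one by (intro sum.cong refl) auto
  also have "\<dots> = complex_of_real (Re (v \<bullet>c v))"
    by (simp add: Re_cscalar_prod_self dv mult.commute, simp only: complex_norm_square[symmetric] of_real_power)
  finally show ?thesis by (simp only: of_real_eq_iff)
qed

lemma kraus_family_dim: "kraus_family d Ks \<Longrightarrow> K \<in> set Ks \<Longrightarrow> dim_col K = d"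
  by (simp add: kraus_family_def)

text \<open>The bounds serve to make the probabilities integrable over the shared randomness. The
  state remains a product vector, and each measurement distributes the squared norm of the acting
  party's factor among the outcomes.\<close>

lemma locc_prob_bounds:
  assumes "locc_valid n dA dB T" "v \<in> carrier_vec dA" "w \<in> carrier_vec dB"
  shows "0 \<le> locc_prob dA dB T a b (kron_vec v w) \<and>
    locc_prob dA dB T a b (kron_vec v w) \<le> Re (v \<bullet>c v) * Re (w \<bullet>c w)"
  using assms
proof (induction arbitrary: v w rule: locc_valid.induct)
  case (Output a' b' n dA dB)
  have "0 \<le> Re (v \<bullet>c v) * Re (w \<bullet>c w)"
    by (simp add: Re_cscalar_prod_self sum_nonneg)
  then show ?case by (simp add: Re_cscalar_prod_kron_vec)
next
  case (Alice dA KTs n dB)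
  have eq: "kron_mat K (1\<^sub>m dB) *\<^sub>v kron_vec v w = kron_vec (K *\<^sub>v v) w" if "(K, T) \<in> set KTs" for K T
    using kraus_family_dim[OF Alice.hyps(1), of K] that Alice.prems
    by (subst kron_mat_mult_kron_vec) force+
  have IH: "0 \<le> locc_prob (dim_row K) dB T a b (kron_vec (K *\<^sub>v v) w) \<and>
      locc_prob (dim_row K) dB T a b (kron_vec (K *\<^sub>v v) w)
        \<le> Re ((K *\<^sub>v v) \<bullet>c (K *\<^sub>v v)) * Re (w \<bullet>c w)"
    if "(K, T) \<in> set KTs" for K T
    by (rule Alice.IH[OF that _ Alice.prems(2)]) (simp add: carrier_vecI)
  have "locc_prob dA dB (Alice KTs) a b (kron_vec v w)
      = (\<Sum>(K, T)\<leftarrow>KTs. locc_prob (dim_row K) dB T a b (kron_vec (K *\<^sub>v v) w))"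
    using eq by (auto intro!: arg_cong[where f = sum_list])
  moreover have "0 \<le> \<dots>"
    using IH by (auto intro!: sum_list_nonneg)
  moreover have "(\<Sum>(K, T)\<leftarrow>KTs. locc_prob (dim_row K) dB T a b (kron_vec (K *\<^sub>v v) w))
      \<le> (\<Sum>(K, T)\<leftarrow>KTs. Re ((K *\<^sub>v v) \<bullet>c (K *\<^sub>v v)) * Re (w \<bullet>c w))"
    using IH by (intro sum_list_mono) auto
  moreover have "\<dots> = (\<Sum>K\<leftarrow>map fst KTs. Re ((K *\<^sub>v v) \<bullet>c (K *\<^sub>v v))) * Re (w \<bullet>c w)"
    by (simp add: sum_list_mult_const[symmetric] case_prod_unfold comp_def)
  ultimately show ?case
    using kraus_family_norm[OF Alice.hyps(1) Alice.prems(1)] by simp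
next
  case (Bob dB KTs n dA)
  have eq: "kron_mat (1\<^sub>m dA) K *\<^sub>v kron_vec v w = kron_vec v (K *\<^sub>v w)" if "(K, T) \<in> set KTs" for K T
    using kraus_family_dim[OF Bob.hyps(1), of K] that Bob.prems
    by (subst kron_mat_mult_kron_vec) force+
  have IH: "0 \<le> locc_prob dA (dim_row K) T a b (kron_vec v (K *\<^sub>v w)) \<and>
      locc_prob dA (dim_row K) T a b (kron_vec v (K *\<^sub>v w))
        \<le> Re (v \<bullet>c v) * Re ((K *\<^sub>v w) \<bullet>c (K *\<^sub>v w))"
    if "(K, T) \<in> set KTs" for K T
    by (rule Bob.IH[OF that Bob.prems(1)]) (simp add: carrier_vecI)
  have "locc_prob dA dB (Bob KTs) a b (kron_vec v w)
      = (\<Sum>(K, T)\<leftarrow>KTs. locc_prob dA (dim_row K) T a b (kron_vec v (K *\<^sub>v w)))"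
    using eq by (auto intro!: arg_cong[where f = sum_list])
  moreover have "0 \<le> \<dots>"
    using IH by (auto intro!: sum_list_nonneg)
  moreover have "(\<Sum>(K, T)\<leftarrow>KTs. locc_prob dA (dim_row K) T a b (kron_vec v (K *\<^sub>v w)))
      \<le> (\<Sum>(K, T)\<leftarrow>KTs. Re (v \<bullet>c v) * Re ((K *\<^sub>v w) \<bullet>c (K *\<^sub>v w)))"
    using IH by (intro sum_list_mono) auto
  moreover have "\<dots> = Re (v \<bullet>c v) * (\<Sum>K\<leftarrow>map fst KTs. Re ((K *\<^sub>v w) \<bullet>c (K *\<^sub>v w)))"
    by (simp add: sum_list_const_mult[symmetric] case_prod_unfold comp_def)
  ultimately show ?case
    using kraus_family_norm[OF Bob.hyps(1) Bob.prems(2)] by simp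
qed

lemma sum_sum_list_swap:
  fixes h :: "'z \<Rightarrow> 'b :: semiring_0"
  shows "(\<Sum>z\<in>Z. h z * (\<Sum>x\<leftarrow>xs. f x z)) = (\<Sum>x\<leftarrow>xs. \<Sum>z\<in>Z. h z * f x z)"
  by (induction xs) (simp_all add: distrib_left sum.distrib)

text \<open>\<open>A\<close> and \<open>B\<close> are the products of the Kraus operators applied so
  far; a measurement replaces \<open>A\<close> by \<open>K * A\<close> or \<open>B\<close> by
  \<open>K * B\<close>. They are the same for all \<open>z\<close> because the protocol does not
  depend on the inputs.\<close>

lemma locc_prob_functional_nonneg:
  fixes \<beta> :: "'z \<Rightarrow> real"
  assumes pos: "\<And>x y. x \<in> carrier_vec dA \<Longrightarrow> y \<in> carrier_vec dB \<Longrightarrow>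
      0 \<le> (\<Sum>z\<in>Z. \<beta> z * ((cmod (x \<bullet> v z))\<^sup>2 * (cmod (y \<bullet> w z))\<^sup>2))"
    and v: "\<And>z. z \<in> Z \<Longrightarrow> v z \<in> carrier_vec dA" and w: "\<And>z. z \<in> Z \<Longrightarrow> w z \<in> carrier_vec dB"
    and "locc_valid n dA' dB' T" "A \<in> carrier_mat dA' dA" "B \<in> carrier_mat dB' dB"
  shows "0 \<le> (\<Sum>z\<in>Z. \<beta> z * locc_prob dA' dB' T a b (kron_vec (A *\<^sub>v v z) (B *\<^sub>v w z)))"
  using assms(4-)
proof (induction arbitrary: A B rule: locc_valid.induct)
  case (Output a' b' n dA' dB')
  \<comment> \<open>At a leaf the squared norm is a sum of squared overlaps of the inputs with rows
    of \<open>A\<close> and \<open>B\<close>, and \<open>pos\<close> applies to each pair of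
    rows.\<close>
  have "(\<Sum>z\<in>Z. \<beta> z * Re (kron_vec (A *\<^sub>v v z) (B *\<^sub>v w z) \<bullet>c kron_vec (A *\<^sub>v v z) (B *\<^sub>v w z)))
      = (\<Sum>z\<in>Z. \<Sum>i<dA'. \<Sum>j<dB'. \<beta> z * ((cmod (row A i \<bullet> v z))\<^sup>2 * (cmod (row B j \<bullet> w z))\<^sup>2))"
    using Output.prems unfolding Re_cscalar_prod_kron_vec
    by (intro sum.cong refl) (simp add: Re_cscalar_prod_self, simp only: sum_product, simp only: sum_distrib_left)
  also have "\<dots> = (\<Sum>i<dA'. \<Sum>j<dB'. \<Sum>z\<in>Z. \<beta> z * ((cmod (row A i \<bullet> v z))\<^sup>2 * (cmod (row B j \<bullet> w z))\<^sup>2))"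
    by (subst sum.swap, rule sum.cong[OF refl], rule sum.swap)
  also have "\<dots> \<ge> 0"
    using Output.prems by (intro sum_nonneg pos) auto
  finally show ?case by (cases "a = a' \<and> b = b'") auto
next
  case (Alice dA' KTs n dB')
  have dim: "dim_col K = dA'" if "(K, T) \<in> set KTs" for K T
    using kraus_family_dim[OF Alice.hyps(1), of K] that by force
  have eq: "kron_mat K (1\<^sub>m dB') *\<^sub>v kron_vec (A *\<^sub>v v z) (B *\<^sub>v w z) = kron_vec ((K * A) *\<^sub>v v z) (B *\<^sub>v w z)"
    if "(K, T) \<in> set KTs" "z \<in> Z" for K T z
  proof -
    have K: "K \<in> carrier_mat (dim_row K) dA'"
      using dim[OF that(1)] by (intro carrier_matI) auto
    have "kron_mat K (1\<^sub>m dB') *\<^sub>v kron_vec (A *\<^sub>v v z) (B *\<^sub>v w z)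
        = kron_vec (K *\<^sub>v (A *\<^sub>v v z)) (1\<^sub>m dB' *\<^sub>v (B *\<^sub>v w z))"
      using K Alice.prems by (intro kron_mat_mult_kron_vec) auto
    also have "1\<^sub>m dB' *\<^sub>v (B *\<^sub>v w z) = B *\<^sub>v w z"
      using Alice.prems(2) w[OF that(2)] by (intro one_mult_mat_vec mult_mat_vec_carrier)
    also have "K *\<^sub>v (A *\<^sub>v v z) = (K * A) *\<^sub>v v z"
      by (rule assoc_mult_mat_vec[symmetric, OF K Alice.prems(1) v[OF that(2)]])
    finally show ?thesis .
  qed
  have "(\<Sum>z\<in>Z. \<beta> z * locc_prob dA' dB' (Alice KTs) a b (kron_vec (A *\<^sub>v v z) (B *\<^sub>v w z)))
      = (\<Sum>(K, T)\<leftarrow>KTs. \<Sum>z\<in>Z. \<beta> z * locc_prob (dim_row K) dB' T a b (kron_vec ((K * A) *\<^sub>v v z) (B *\<^sub>v w z)))"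
    unfolding locc_prob.simps sum_sum_list_swap
    using eq by (auto intro!: arg_cong[where f = sum_list] sum.cong)
  moreover have "0 \<le> \<dots>"
  proof (rule sum_list_nonneg, clarsimp)
    fix K T assume KT: "(K, T) \<in> set KTs"
    show "0 \<le> (\<Sum>z\<in>Z. \<beta> z * locc_prob (dim_row K) dB' T a b (kron_vec ((K * A) *\<^sub>v v z) (B *\<^sub>v w z)))"
      using Alice.prems dim[OF KT] by (intro Alice.IH[OF KT]) (auto intro!: carrier_matI)
  qed
  ultimately show ?case by simp
next
  case (Bob dB' KTs n dA')
  have dim: "dim_col K = dB'" if "(K, T) \<in> set KTs" for K T
    using kraus_family_dim[OF Bob.hyps(1), of K] that by force
  have eq: "kron_mat (1\<^sub>m dA') K *\<^sub>v kron_vec (A *\<^sub>v v z) (B *\<^sub>v w z) = kron_vec (A *\<^sub>v v z) ((K * B) *\<^sub>v w z)"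
    if "(K, T) \<in> set KTs" "z \<in> Z" for K T z
  proof -
    have K: "K \<in> carrier_mat (dim_row K) dB'"
      using dim[OF that(1)] by (intro carrier_matI) auto
    have "kron_mat (1\<^sub>m dA') K *\<^sub>v kron_vec (A *\<^sub>v v z) (B *\<^sub>v w z)
        = kron_vec (1\<^sub>m dA' *\<^sub>v (A *\<^sub>v v z)) (K *\<^sub>v (B *\<^sub>v w z))"
      using K Bob.prems by (intro kron_mat_mult_kron_vec) auto
    also have "1\<^sub>m dA' *\<^sub>v (A *\<^sub>v v z) = A *\<^sub>v v z"
      using Bob.prems(1) v[OF that(2)] by (intro one_mult_mat_vec mult_mat_vec_carrier)
    also have "K *\<^sub>v (B *\<^sub>v w z) = (K * B) *\<^sub>v w z"
      by (rule assoc_mult_mat_vec[symmetric, OF K Bob.prems(2) w[OF that(2)]])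
    finally show ?thesis .
  qed
  have "(\<Sum>z\<in>Z. \<beta> z * locc_prob dA' dB' (Bob KTs) a b (kron_vec (A *\<^sub>v v z) (B *\<^sub>v w z)))
      = (\<Sum>(K, T)\<leftarrow>KTs. \<Sum>z\<in>Z. \<beta> z * locc_prob dA' (dim_row K) T a b (kron_vec (A *\<^sub>v v z) ((K * B) *\<^sub>v w z)))"
    unfolding locc_prob.simps sum_sum_list_swap
    using eq by (auto intro!: arg_cong[where f = sum_list] sum.cong)
  moreover have "0 \<le> \<dots>"
  proof (rule sum_list_nonneg, clarsimp)
    fix K T assume KT: "(K, T) \<in> set KTs"
    show "0 \<le> (\<Sum>z\<in>Z. \<beta> z * locc_prob dA' (dim_row K) T a b (kron_vec (A *\<^sub>v v z) ((K * B) *\<^sub>v w z)))"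
      using Bob.prems dim[OF KT] by (intro Bob.IH[OF KT]) (auto intro!: carrier_matI)
  qed
  ultimately show ?case by simp
qed

text \<open>The functional is linear in \<open>P\<close>, so its value is the average over the
  shared randomness of its values for the individual trees.\<close>

lemma finite_round_locc_functional_nonneg:
  fixes \<beta> :: "'z \<Rightarrow> real"
  assumes pos: "\<And>x y. x \<in> carrier_vec dA \<Longrightarrow> y \<in> carrier_vec dB \<Longrightarrow>
      0 \<le> (\<Sum>z\<in>Z. \<beta> z * ((cmod (x \<bullet> v z))\<^sup>2 * (cmod (y \<bullet> w z))\<^sup>2))"
    and v: "\<And>z. z \<in> Z \<Longrightarrow> v z \<in> carrier_vec dA \<inter> V"
    and w: "\<And>z. z \<in> Z \<Longrightarrow> w z \<in> carrier_vec dB \<inter> W"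
    and "finite_round_locc dA dB V W P" "a \<in> {0, 1}" "b \<in> {0, 1}"
  shows "0 \<le> (\<Sum>z\<in>Z. \<beta> z * P a b (v z) (w z))"
proof -
  obtain \<mu> :: "locc_tree measure" and T n where "prob_space \<mu>"
    and valid: "\<And>l. l \<in> space \<mu> \<Longrightarrow> locc_valid n dA dB (T l)"
    and meas: "\<And>z. z \<in> Z \<Longrightarrow>
        (\<lambda>l. locc_prob dA dB (T l) a b (kron_vec (v z) (w z))) \<in> borel_measurable \<mu>"
    and P: "\<And>z. z \<in> Z \<Longrightarrow>
        P a b (v z) (w z) = (\<integral>l. locc_prob dA dB (T l) a b (kron_vec (v z) (w z)) \<partial>\<mu>)"
    using assms unfolding finite_round_locc_def locc_protocol_correlation_def by blast
  interpret prob_space \<mu> by fact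
  have int: "integrable \<mu> (\<lambda>l. locc_prob dA dB (T l) a b (kron_vec (v z) (w z)))" if "z \<in> Z" for z
  proof (rule integrable_const_bound)
    show "AE l in \<mu>. norm (locc_prob dA dB (T l) a b (kron_vec (v z) (w z)))
        \<le> Re (v z \<bullet>c v z) * Re (w z \<bullet>c w z)"
      using locc_prob_bounds[OF valid, of _ "v z" "w z" a b] v[OF that] w[OF that]
      by (intro AE_I2) auto
  qed (rule meas[OF that])
  have "(\<Sum>z\<in>Z. \<beta> z * P a b (v z) (w z))
      = (\<Sum>z\<in>Z. \<integral>l. \<beta> z * locc_prob dA dB (T l) a b (kron_vec (v z) (w z)) \<partial>\<mu>)"
    by (simp add: P)
  also have "\<dots> = (\<integral>l. (\<Sum>z\<in>Z. \<beta> z * locc_prob dA dB (T l) a b (kron_vec (v z) (w z))) \<partial>\<mu>)"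
    using int by (intro Bochner_Integration.integral_sum[symmetric]) simp
  also have "\<dots> \<ge> 0"
  proof (rule Bochner_Integration.integral_nonneg)
    fix l assume l: "l \<in> space \<mu>"
    \<comment> \<open>Before the first round no Kraus operator has acted, so both accumulated
      operators are identities.\<close>
    have "0 \<le> (\<Sum>z\<in>Z. \<beta> z * locc_prob dA dB (T l) a b
        (kron_vec (1\<^sub>m dA *\<^sub>v v z) (1\<^sub>m dB *\<^sub>v w z)))"
      by (rule locc_prob_functional_nonneg[OF pos _ _ valid[OF l]]) (use v w in auto)
    also have "\<dots> = (\<Sum>z\<in>Z. \<beta> z * locc_prob dA dB (T l) a b (kron_vec (v z) (w z)))"
      using v w by (intro sum.cong refl) simp
    finally show "0 \<le> \<dots>" .
  qed
  finally show ?thesis .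
qed

text \<open>The functional is continuous under pointwise convergence, so nonnegativity passes from
  finite-round correlations to their limits.\<close>

lemma locc_functional_nonneg:
  fixes \<beta> :: "'z \<Rightarrow> real"
  assumes pos: "\<And>x y. x \<in> carrier_vec dA \<Longrightarrow> y \<in> carrier_vec dB \<Longrightarrow>
      0 \<le> (\<Sum>z\<in>Z. \<beta> z * ((cmod (x \<bullet> v z))\<^sup>2 * (cmod (y \<bullet> w z))\<^sup>2))"
    and v: "\<And>z. z \<in> Z \<Longrightarrow> v z \<in> carrier_vec dA \<inter> V"
    and w: "\<And>z. z \<in> Z \<Longrightarrow> w z \<in> carrier_vec dB \<inter> W"
    and P: "locc_correlation dA dB V W P" and ab: "a \<in> {0, 1}" "b \<in> {0, 1}"
  shows "0 \<le> (\<Sum>z\<in>Z. \<beta> z * P a b (v z) (w z))"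
proof -
  have fin: "0 \<le> (\<Sum>z\<in>Z. \<beta> z * P' a b (v z) (w z))" if "finite_round_locc dA dB V W P'" for P'
    using pos v w that ab by (rule finite_round_locc_functional_nonneg)
  from P consider "finite_round_locc dA dB V W P"
    | Q where "\<And>k::nat. finite_round_locc dA dB V W (Q k)"
      "\<And>z. z \<in> Z \<Longrightarrow> (\<lambda>k. Q k a b (v z) (w z)) \<longlonglongrightarrow> P a b (v z) (w z)"
    using v w ab unfolding locc_correlation_def by blast
  then show ?thesis
  proof cases
    case 1
    then show ?thesis by (rule fin)
  next
    case 2
    have "(\<lambda>k. \<Sum>z\<in>Z. \<beta> z * Q k a b (v z) (w z)) \<longlonglongrightarrow> (\<Sum>z\<in>Z. \<beta> z * P a b (v z) (w z))"
      by (intro tendsto_sum tendsto_mult_left 2)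
    moreover have "\<forall>\<^sub>F k in sequentially. 0 \<le> (\<Sum>z\<in>Z. \<beta> z * Q k a b (v z) (w z))"
      by (intro always_eventually allI fin 2)
    ultimately show ?thesis by (rule tendsto_lowerbound) simp
  qed
qed

section \<open>Product forms and informational completeness\<close>

text \<open>\<open>tr (X (M\<^sup>T \<otimes> N\<^sup>T))\<close>. For \<open>M = |v\<rangle>\<langle>v|\<close> and \<open>N = |w\<rangle>\<langle>w|\<close> it is, up to the
  factor \<open>dA * dB\<close>, the probability that both projections onto the maximally entangled state
  succeed.\<close>

definition product_form ::
  "nat \<Rightarrow> nat \<Rightarrow> complex mat \<Rightarrow> (nat \<Rightarrow> nat \<Rightarrow> complex) \<Rightarrow> (nat \<Rightarrow> nat \<Rightarrow> complex) \<Rightarrow> complex" where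
  "product_form dA dB X M N =
     (\<Sum>i<dA. \<Sum>k<dA. \<Sum>j<dB. \<Sum>l<dB. X $$ (i * dB + j, k * dB + l) * (M i k * N j l))"

text \<open>The entries of \<open>ketbra v\<close> as a function of two indices, so that linear
  combinations can be formed pointwise, without dimensions.\<close>

definition outer :: "complex vec \<Rightarrow> nat \<Rightarrow> nat \<Rightarrow> complex" where
  "outer v i k = v $ i * cnj (v $ k)"

lemma product_form_sum_left:
  "product_form dA dB X (\<lambda>i k. \<Sum>s\<in>S. c s * M s i k) N = (\<Sum>s\<in>S. c s * product_form dA dB X (M s) N)"
  by (induction S rule: infinite_finite_induct)
    (simp_all add: product_form_def sum.distrib sum_distrib_left distrib_left distrib_right mult_ac)

lemma product_form_sum_right:
  "product_form dA dB X M (\<lambda>j l. \<Sum>t\<in>S. c t * N t j l) = (\<Sum>t\<in>S. c t * product_form dA dB X M (N t))"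
  by (induction S rule: infinite_finite_induct)
    (simp_all add: product_form_def sum.distrib sum_distrib_left distrib_left distrib_right mult_ac)

lemma product_form_cong:
  assumes "\<And>i k. i < dA \<Longrightarrow> k < dA \<Longrightarrow> M i k = M' i k"
    and "\<And>j l. j < dB \<Longrightarrow> l < dB \<Longrightarrow> N j l = N' j l"
  shows "product_form dA dB X M N = product_form dA dB X M' N'"
  unfolding product_form_def using assms by (intro sum.cong refl) auto

text \<open>Bilinearity, to be used with expansions of matrix units and of the identity in the input
  states. Agreement below the dimensions suffices, as no other entries enter the form.\<close>

lemma product_form_lincomb:
  assumes "\<And>i k. i < dA \<Longrightarrow> k < dA \<Longrightarrow> (\<Sum>s\<in>S. c s * M s i k) = M' i k"
    and "\<And>j l. j < dB \<Longrightarrow> l < dB \<Longrightarrow> (\<Sum>t\<in>T. c' t * N t j l) = N' j l"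
  shows "product_form dA dB X M' N'
    = (\<Sum>s\<in>S. \<Sum>t\<in>T. c s * c' t * product_form dA dB X (M s) (N t))"
proof -
  have "product_form dA dB X M' N'
      = product_form dA dB X (\<lambda>i k. \<Sum>s\<in>S. c s * M s i k) (\<lambda>j l. \<Sum>t\<in>T. c' t * N t j l)"
    using assms by (intro product_form_cong) auto
  then show ?thesis
    by (simp add: product_form_sum_left product_form_sum_right sum_distrib_left mult.assoc)
qed

lemma product_form_mat_sum:
  assumes "\<And>k. k \<in> S \<Longrightarrow> M k \<in> carrier_mat (dA * dB) (dA * dB)"
  shows "product_form dA dB (mat_sum (dA * dB) (dA * dB) (\<lambda>k. c k \<cdot>\<^sub>m M k) S) V W
    = (\<Sum>k\<in>S. c k * product_form dA dB (M k) V W)"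
proof -
  have ind: "product_form dA dB (mat (dA * dB) (dA * dB) (\<lambda>ij. \<Sum>k\<in>S. c k * M k $$ ij)) V W
      = (\<Sum>k\<in>S. c k * product_form dA dB (M k) V W)"
    by (induction S rule: infinite_finite_induct)
      (simp_all add: product_form_def mult_add_less_mult sum.distrib sum_distrib_left
        distrib_left distrib_right mult_ac)
  have "mat_sum (dA * dB) (dA * dB) (\<lambda>k. c k \<cdot>\<^sub>m M k) S
      = mat (dA * dB) (dA * dB) (\<lambda>ij. \<Sum>k\<in>S. c k * M k $$ ij)"
    unfolding mat_sum_def
  proof (rule eq_matI)
    fix i j assume "i < dim_row (mat (dA * dB) (dA * dB) (\<lambda>ij. \<Sum>k\<in>S. c k * M k $$ ij))"
      "j < dim_col (mat (dA * dB) (dA * dB) (\<lambda>ij. \<Sum>k\<in>S. c k * M k $$ ij))"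
    then have ij: "i < dA * dB" "j < dA * dB" by simp_all
    have "(c k \<cdot>\<^sub>m M k) $$ (i, j) = c k * M k $$ (i, j)" if "k \<in> S" for k
      using assms[OF that] ij by simp
    then show "mat (dA * dB) (dA * dB) (\<lambda>ij. \<Sum>k\<in>S. (c k \<cdot>\<^sub>m M k) $$ ij) $$ (i, j)
        = mat (dA * dB) (dA * dB) (\<lambda>ij. \<Sum>k\<in>S. c k * M k $$ ij) $$ (i, j)"
      using ij by simp
  qed simp_all
  with ind show ?thesis by simp
qed

text \<open>The fourfold sum factorises over the two tensor factors, each giving a sum times its
  conjugate. Because of the transposes, \<open>a\<close> and \<open>b\<close> enter without
  conjugation, just as a row of a Kraus operator meets an input.\<close>

lemma product_form_kron_ketbra:
  assumes "dim_vec a = dA" "dim_vec b = dB"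
  shows "product_form dA dB (kron_mat (ketbra a) (ketbra b)) (outer v) (outer w)
    = complex_of_real ((cmod (\<Sum>i<dA. a $ i * v $ i))\<^sup>2 * (cmod (\<Sum>j<dB. b $ j * w $ j))\<^sup>2)"
proof -
  have "product_form dA dB (kron_mat (ketbra a) (ketbra b)) (outer v) (outer w)
    = (\<Sum>i<dA. \<Sum>k<dA. \<Sum>j<dB. \<Sum>l<dB.
        ((a $ i * v $ i) * cnj (a $ k * v $ k)) * ((b $ j * w $ j) * cnj (b $ l * w $ l)))"
    unfolding product_form_def
  proof (intro sum.cong refl)
    fix i k j l assume "i \<in> {..<dA}" "k \<in> {..<dA}" "j \<in> {..<dB}" "l \<in> {..<dB}"
    then show "kron_mat (ketbra a) (ketbra b) $$ (i * dB + j, k * dB + l) * (outer v i k * outer w j l)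
      = ((a $ i * v $ i) * cnj (a $ k * v $ k)) * ((b $ j * w $ j) * cnj (b $ l * w $ l))"
      using index_kron_mat[of i "ketbra a" j "ketbra b" k l] assms by (simp add: outer_def)
  qed
  also have "\<dots> = (\<Sum>i<dA. \<Sum>k<dA. (a $ i * v $ i) * cnj (a $ k * v $ k)) *
      (\<Sum>j<dB. \<Sum>l<dB. (b $ j * w $ j) * cnj (b $ l * w $ l))"
    by (simp only: sum_distrib_right, simp only: sum_distrib_left)
  finally show ?thesis
    by (simp only: complex_norm_square of_real_mult cnj_sum sum_product)
qed

text \<open>Conjugation exchanges row and column indices in \<open>X\<close> and in both inputs;
  renaming the summation indices restores the form.\<close>

lemma product_form_hermitian_real:
  assumes X: "X \<in> carrier_mat (dA * dB) (dA * dB)" "mat_adjoint X = X"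
  shows "product_form dA dB X (outer v) (outer w)
    = complex_of_real (Re (product_form dA dB X (outer v) (outer w)))"
proof -
  have herm: "cnj (X $$ (i * dB + j, k * dB + l)) = X $$ (k * dB + l, i * dB + j)"
    if "i < dA" "j < dB" "k < dA" "l < dB" for i j k l
    using index_mat_adjoint[of "k * dB + l" X "i * dB + j"] X that
    by (simp add: mult_add_less_mult)
  have "cnj (product_form dA dB X (outer v) (outer w))
    = (\<Sum>i<dA. \<Sum>k<dA. \<Sum>j<dB. \<Sum>l<dB. X $$ (k * dB + l, i * dB + j) * (outer v k i * outer w l j))"
    unfolding product_form_def cnj_sum
    by (intro sum.cong refl) (simp add: herm outer_def mult_ac)
  also have "\<dots> = (\<Sum>k<dA. \<Sum>i<dA. \<Sum>l<dB. \<Sum>j<dB. X $$ (k * dB + l, i * dB + j) * (outer v k i * outer w l j))"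
    by (subst sum.swap, rule sum.cong[OF refl], rule sum.cong[OF refl], rule sum.swap)
  also have "\<dots> = product_form dA dB X (outer v) (outer w)"
    by (simp only: product_form_def)
  finally show ?thesis
    by (metis Reals_cnj_iff of_real_Re)
qed

lemma sum_lessThan_single:
  fixes f :: "nat \<Rightarrow> 'a :: comm_monoid_add"
  assumes "i0 < d" "\<And>i. i \<noteq> i0 \<Longrightarrow> f i = 0"
  shows "(\<Sum>i<d. f i) = f i0"
proof -
  have "(\<Sum>i<d. f i) = (\<Sum>i\<in>{i0}. f i)"
    using assms by (intro sum.mono_neutral_right) auto
  then show ?thesis by simp
qed

lemma product_form_units:
  assumes "i0 < dA" "k0 < dA" "j0 < dB" "l0 < dB"
  shows "product_form dA dB X (\<lambda>i k. of_bool (i = i0 \<and> k = k0)) (\<lambda>j l. of_bool (j = j0 \<and> l = l0))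
    = X $$ (i0 * dB + j0, k0 * dB + l0)"
  unfolding product_form_def using assms
  by (simp add: sum_lessThan_single[of i0 dA] sum_lessThan_single[of k0 dA]
      sum_lessThan_single[of j0 dB] sum_lessThan_single[of l0 dB])

text \<open>This makes the normalisation by the trace a linear condition on the values of the form
  at the inputs.\<close>

lemma product_form_identity:
  assumes "dim_row X = dA * dB"
  shows "product_form dA dB X (\<lambda>i k. of_bool (i = k)) (\<lambda>j l. of_bool (j = l)) = mat_trace X"
  unfolding product_form_def mat_trace_def assms sum_lessThan_times
proof (rule sum.cong[OF refl])
  fix i assume "i \<in> {..<dA}"
  then have "(\<Sum>k<dA. \<Sum>j<dB. \<Sum>l<dB. X $$ (i * dB + j, k * dB + l) * (of_bool (i = k) * of_bool (j = l)))
      = (\<Sum>j<dB. \<Sum>l<dB. X $$ (i * dB + j, i * dB + l) * of_bool (j = l))"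
    by (subst sum_lessThan_single[of i dA]) auto
  also have "\<dots> = (\<Sum>j<dB. X $$ (i * dB + j, i * dB + j))"
  proof (rule sum.cong[OF refl])
    fix j assume "j \<in> {..<dB}"
    then show "(\<Sum>l<dB. X $$ (i * dB + j, i * dB + l) * of_bool (j = l)) = X $$ (i * dB + j, i * dB + j)"
      by (subst sum_lessThan_single[of j dB]) auto
  qed
  finally show "(\<Sum>k<dA. \<Sum>j<dB. \<Sum>l<dB. X $$ (i * dB + j, k * dB + l) * (of_bool (i = k) * of_bool (j = l)))
      = (\<Sum>j<dB. X $$ (i * dB + j, i * dB + j))" .
qed

section \<open>Reconstruction from informationally complete inputs\<close>

lemma informationally_complete_coefficients:
  assumes "informationally_complete d S \<phi>" "\<And>s. s \<in> S \<Longrightarrow> dim_vec (\<phi> s) = d"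
  obtains c where "\<And>i k. i < d \<Longrightarrow> k < d \<Longrightarrow> (\<Sum>s\<in>S. c s * outer (\<phi> s) i k) = E i k"
proof -
  have "mat d d (\<lambda>(i, k). E i k) \<in> carrier_mat d d" by simp
  then obtain c where c: "mat d d (\<lambda>(i, k). E i k) = mat_sum d d (\<lambda>s. c s \<cdot>\<^sub>m ketbra (\<phi> s)) S"
    using assms(1) unfolding informationally_complete_def by blast
  show thesis
  proof (rule that)
    fix i k assume ik: "i < d" "k < d"
    have "E i k = mat_sum d d (\<lambda>s. c s \<cdot>\<^sub>m ketbra (\<phi> s)) S $$ (i, k)"
      using ik by (simp flip: c)
    also have "\<dots> = (\<Sum>s\<in>S. c s * outer (\<phi> s) i k)"
      using ik assms(2) by (auto simp: mat_sum_def outer_def intro!: sum.cong)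
    finally show "(\<Sum>s\<in>S. c s * outer (\<phi> s) i k) = E i k" ..
  qed
qed

text \<open>Matrix units are linear combinations of the input states, so each entry is a linear
  combination of the values at the inputs, with coefficients that do not depend on the
  matrix.\<close>

lemma product_form_eqI:
  assumes "informationally_complete dA S \<phi>" "\<And>s. s \<in> S \<Longrightarrow> dim_vec (\<phi> s) = dA"
    and "informationally_complete dB T \<psi>" "\<And>t. t \<in> T \<Longrightarrow> dim_vec (\<psi> t) = dB"
    and X: "X \<in> carrier_mat (dA * dB) (dA * dB)" and Y: "Y \<in> carrier_mat (dA * dB) (dA * dB)"
    and eq: "\<And>s t. s \<in> S \<Longrightarrow> t \<in> T \<Longrightarrow>
      product_form dA dB X (outer (\<phi> s)) (outer (\<psi> t)) = product_form dA dB Y (outer (\<phi> s)) (outer (\<psi> t))"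
  shows "X = Y"
proof (rule eq_matI)
  fix x y assume "x < dim_row Y" "y < dim_col Y"
  then have xy: "x < dA * dB" "y < dA * dB" using Y by auto
  define i0 j0 k0 l0 where "i0 = x div dB" and "j0 = x mod dB" and "k0 = y div dB" and "l0 = y mod dB"
  have idx: "i0 < dA" "k0 < dA" "j0 < dB" "l0 < dB" "x = i0 * dB + j0" "y = k0 * dB + l0"
    using xy by (auto simp: i0_def j0_def k0_def l0_def less_mult_imp_div_less intro!: mod_less_divisor gr0I)
  obtain c where c: "\<And>i k. i < dA \<Longrightarrow> k < dA \<Longrightarrow> (\<Sum>s\<in>S. c s * outer (\<phi> s) i k) = of_bool (i = i0 \<and> k = k0)"
    using informationally_complete_coefficients[OF assms(1,2), where E = "\<lambda>i k. of_bool (i = i0 \<and> k = k0)"]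
    by blast
  obtain c' where c': "\<And>j l. j < dB \<Longrightarrow> l < dB \<Longrightarrow> (\<Sum>t\<in>T. c' t * outer (\<psi> t) j l) = of_bool (j = j0 \<and> l = l0)"
    using informationally_complete_coefficients[OF assms(3,4), where E = "\<lambda>j l. of_bool (j = j0 \<and> l = l0)"]
    by blast
  have entry: "Z $$ (x, y) = (\<Sum>s\<in>S. \<Sum>t\<in>T. c s * c' t * product_form dA dB Z (outer (\<phi> s)) (outer (\<psi> t)))" for Z
    unfolding idx(5,6) product_form_units[OF idx(1-4), symmetric]
    by (rule product_form_lincomb) (fact c c')+
  show "X $$ (x, y) = Y $$ (x, y)"
    unfolding entry using eq by (auto intro!: sum.cong)
qed (use X Y in auto)

text \<open>Input states and the identity are Hermitian, so averaging an expansion with its adjoint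
  replaces the coefficients by their real parts. The separation takes place in a real space and
  needs real coefficients.\<close>

lemma identity_real_coefficients:
  assumes "informationally_complete d S \<phi>" "\<And>s. s \<in> S \<Longrightarrow> dim_vec (\<phi> s) = d"
  obtains c :: "'i \<Rightarrow> real" where "\<And>i k. i < d \<Longrightarrow> k < d \<Longrightarrow>
    (\<Sum>s\<in>S. complex_of_real (c s) * outer (\<phi> s) i k) = of_bool (i = k)"
proof -
  obtain c where c: "\<And>i k. i < d \<Longrightarrow> k < d \<Longrightarrow> (\<Sum>s\<in>S. c s * outer (\<phi> s) i k) = of_bool (i = k)"
    using informationally_complete_coefficients[OF assms, where E = "\<lambda>i k. of_bool (i = k)"] by blast
  show thesis
  proof (rule that[of "\<lambda>s. Re (c s)"])
    fix i k assume ik: "i < d" "k < d"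
    have Re: "complex_of_real (Re z) = (z + cnj z) / 2" for z
      by (simp add: complex_add_cnj)
    have "(\<Sum>s\<in>S. complex_of_real (Re (c s)) * outer (\<phi> s) i k)
        = (\<Sum>s\<in>S. (c s * outer (\<phi> s) i k + cnj (c s * outer (\<phi> s) k i)) / 2)"
      unfolding Re by (intro sum.cong refl) (simp add: outer_def field_simps)
    also have "\<dots> = ((\<Sum>s\<in>S. c s * outer (\<phi> s) i k) + cnj (\<Sum>s\<in>S. c s * outer (\<phi> s) k i)) / 2"
      by (simp only: sum_divide_distrib[symmetric] sum.distrib cnj_sum)
    also have "\<dots> = of_bool (i = k)"
      using ik by (simp add: c del: cnj_sum complex_cnj_mult)
    finally show "(\<Sum>s\<in>S. complex_of_real (Re (c s)) * outer (\<phi> s) i k) = of_bool (i = k)" .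
  qed
qed

text \<open>The expansion of the identity, evaluated as a quadratic form in \<open>a\<close>. For
  unit vectors the value is 1, which is the normalisation required of the points to be separated
  from.\<close>

lemma identity_coefficients_norm:
  assumes c: "\<And>i k. i < d \<Longrightarrow> k < d \<Longrightarrow>
    (\<Sum>s\<in>S. complex_of_real (c s) * outer (\<phi> s) i k) = of_bool (i = k)"
  shows "(\<Sum>s\<in>S. c s * (cmod (\<Sum>i<d. a i * \<phi> s $ i))\<^sup>2) = (\<Sum>i<d. (cmod (a i))\<^sup>2)"
proof -
  have "complex_of_real (\<Sum>s\<in>S. c s * (cmod (\<Sum>i<d. a i * \<phi> s $ i))\<^sup>2)
      = (\<Sum>s\<in>S. complex_of_real (c s) * (\<Sum>i<d. \<Sum>k<d. (a i * \<phi> s $ i) * cnj (a k * \<phi> s $ k)))"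
    by (simp only: of_real_sum of_real_mult complex_norm_square cnj_sum sum_product)
  also have "\<dots> = (\<Sum>s\<in>S. \<Sum>i<d. \<Sum>k<d. a i * cnj (a k) * (complex_of_real (c s) * outer (\<phi> s) i k))"
    unfolding sum_distrib_left by (intro sum.cong refl) (simp add: outer_def mult_ac)
  also have "\<dots> = (\<Sum>i<d. \<Sum>k<d. \<Sum>s\<in>S. a i * cnj (a k) * (complex_of_real (c s) * outer (\<phi> s) i k))"
    by (subst sum.swap, rule sum.cong[OF refl], rule sum.swap)
  also have "\<dots> = (\<Sum>i<d. \<Sum>k<d. if i = k then a i * cnj (a k) else 0)"
    unfolding sum_distrib_left[symmetric] by (intro sum.cong refl) (simp add: c)
  also have "\<dots> = complex_of_real (\<Sum>i<d. (cmod (a i))\<^sup>2)"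
    by (simp add: complex_norm_square del: of_real_power)
  finally show ?thesis by (simp only: of_real_eq_iff)
qed

section \<open>Teleportation by projections onto maximally entangled states\<close>

lemma index_max_entangled:
  assumes "i < d" "k < d"
  shows "max_entangled d $ (i * d + k) = of_bool (i = k) / complex_of_real (sqrt (real d))"
proof -
  have "(\<Sum>m<d. kron_vec (unit_vec d m) (unit_vec d m) $ (i * d + k))
      = (\<Sum>m<d. if m = i then of_bool (i = k) else (0 :: complex))"
    using assms index_kron_vec[of i "unit_vec d _" k "unit_vec d _"] by (intro sum.cong refl) auto
  then show ?thesis
    using assms by (simp add: max_entangled_def mult_add_less_mult)
qed

text \<open>The vector is supported on the diagonal, so contracting with it identifies the indices
  of the two systems.\<close>

lemma sum_max_entangled:
  "(\<Sum>x<d * d. max_entangled d $ x * f x)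
    = (\<Sum>i<d. f (i * d + i)) / complex_of_real (sqrt (real d))"
proof -
  have "(\<Sum>x<d * d. max_entangled d $ x * f x)
      = (\<Sum>i<d. \<Sum>k<d. if i = k then f (i * d + k) / complex_of_real (sqrt (real d)) else 0)"
    unfolding sum_lessThan_times by (intro sum.cong refl) (simp add: index_max_entangled)
  then show ?thesis by (simp add: sum_divide_distrib)
qed

lemma cnj_max_entangled: "x < d * d \<Longrightarrow> cnj (max_entangled d $ x) = max_entangled d $ x"
  by (auto simp: max_entangled_def kron_vec_def unit_vec_def cnj_sum less_mult_imp_div_less
      intro!: sum.cong)

text \<open>The ket and the bra of each projector identify the indices of an input system with those
  of Alice's or Bob's part of \<rho>. This leaves \<rho> paired with the transposed inputs, and the
  four square roots from the contractions combine to \<open>real dA * real dB\<close>.\<close>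

lemma quantum_correlation_eq_product_form:
  assumes "dim_row \<rho> = dA * dB" "dim_col \<rho> = dA * dB" "dim_vec v = dA" "dim_vec w = dB"
  shows "quantum_correlation dA dB \<rho> 1 1 v w
    = Re (product_form dA dB \<rho> (outer v) (outer w)) / (real dA * real dB)"
proof -
  define D where "D = dB * dB"
  define M where "M = kron_mat (ketbra (max_entangled dA)) (ketbra (max_entangled dB))"
  define Y where "Y = kron_mat (kron_mat (ketbra v) \<rho>) (ketbra w)"
  have dim: "dim_vec (max_entangled d) = d * d" for d by (simp add: max_entangled_def)
  have dims: "dim_row M = dA * dA * D" "dim_col M = dA * dA * D"
    "dim_row Y = dA * dA * D" "dim_col Y = dA * dA * D"
    using assms by (simp_all add: M_def Y_def D_def dim mult_ac)
  have MY: "M $$ (x1 * D + x2, y1 * D + y2)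
      = max_entangled dA $ x1 * (max_entangled dB $ x2 * (max_entangled dA $ y1 * max_entangled dB $ y2))"
    if "x1 < dA * dA" "x2 < D" "y1 < dA * dA" "y2 < D" for x1 x2 y1 y2
    using that index_kron_mat[of x1 "ketbra (max_entangled dA)" x2 "ketbra (max_entangled dB)" y1 y2]
    by (simp add: M_def D_def dim cnj_max_entangled)
  have Yij: "Y $$ ((k * dA + k) * D + (l * dB + l), (i * dA + i) * D + (j * dB + j))
      = \<rho> $$ (k * dB + l, i * dB + j) * (outer v k i * outer w l j)"
    if "i < dA" "k < dA" "j < dB" "l < dB" for i j k l
  proof -
    \<comment> \<open>The projectors group the systems as A'A and BB', the state as A', AB and B';
      this rewrites an index of the first grouping for the second.\<close>
    have split: "(k * dA + k) * D + (l * dB + l) = (k * (dA * dB) + (k * dB + l)) * dB + l" for k l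
      by (simp add: D_def algebra_simps)
    have "kron_mat (ketbra v) \<rho> $$ (k * (dA * dB) + (k * dB + l), i * (dA * dB) + (i * dB + j))
        = outer v k i * \<rho> $$ (k * dB + l, i * dB + j)"
      using index_kron_mat[of k "ketbra v" "k * dB + l" \<rho> i "i * dB + j"] assms that
      by (simp add: mult_add_less_mult outer_def)
    moreover have "k * (dA * dB) + (k * dB + l) < dA * (dA * dB)" "i * (dA * dB) + (i * dB + j) < dA * (dA * dB)"
      using that by (intro mult_add_less_mult; simp)+
    ultimately show ?thesis
      unfolding split Y_def
      using index_kron_mat[of "k * (dA * dB) + (k * dB + l)" "kron_mat (ketbra v) \<rho>" l "ketbra w"
          "i * (dA * dB) + (i * dB + j)" j] assms that
      by (simp add: outer_def)
  qed
  have "mat_trace (M * Y) = (\<Sum>x<dA * dA * D. \<Sum>y<dA * dA * D. M $$ (x, y) * Y $$ (y, x))"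
    using dims by (simp add: mat_trace_def scalar_prod_def atLeast0LessThan)
  also have "\<dots> = (\<Sum>x1<dA * dA. \<Sum>x2<D. \<Sum>y1<dA * dA. \<Sum>y2<D.
      max_entangled dA $ x1 * (max_entangled dB $ x2 * (max_entangled dA $ y1 * (max_entangled dB $ y2
        * Y $$ (y1 * D + y2, x1 * D + x2)))))"
    unfolding sum_lessThan_times[of _ "dA * dA" D] by (intro sum.cong refl) (simp add: MY mult.assoc)
  also have "\<dots> = (\<Sum>i<dA. \<Sum>j<dB. \<Sum>k<dA. \<Sum>l<dB.
      \<rho> $$ (k * dB + l, i * dB + j) * (outer v k i * outer w l j)) / (complex_of_real (real dA * real dB))"
  proof -
    have "complex_of_real (sqrt (real d)) * complex_of_real (sqrt (real d)) = of_nat d" for d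
      by (simp flip: of_real_mult)
    then have norm: "x / complex_of_real (sqrt (real dB)) / complex_of_real (sqrt (real dA))
        / complex_of_real (sqrt (real dB)) / complex_of_real (sqrt (real dA))
        = x / complex_of_real (real dA * real dB)" for x
      by (simp add: mult_ac)
    show ?thesis
      unfolding D_def sum_distrib_left[symmetric] sum_max_entangled sum_divide_distrib[symmetric] norm
      by (simp add: Yij[unfolded D_def])
  qed
  also have "(\<Sum>i<dA. \<Sum>j<dB. \<Sum>k<dA. \<Sum>l<dB. \<rho> $$ (k * dB + l, i * dB + j) * (outer v k i * outer w l j))
      = product_form dA dB \<rho> (outer v) (outer w)"
  proof -
    have "(\<Sum>i<dA. \<Sum>j<dB. \<Sum>k<dA. \<Sum>l<dB. f i j k l) = (\<Sum>k<dA. \<Sum>i<dA. \<Sum>l<dB. \<Sum>j<dB. f i j k l)"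
      for f :: "_ \<Rightarrow> _ \<Rightarrow> _ \<Rightarrow> _ \<Rightarrow> complex"
    proof -
      have "(\<Sum>i<dA. \<Sum>j<dB. \<Sum>k<dA. \<Sum>l<dB. f i j k l) = (\<Sum>i<dA. \<Sum>k<dA. \<Sum>j<dB. \<Sum>l<dB. f i j k l)"
        by (rule sum.cong[OF refl], rule sum.swap)
      also have "\<dots> = (\<Sum>k<dA. \<Sum>i<dA. \<Sum>l<dB. \<Sum>j<dB. f i j k l)"
        by (subst sum.swap, rule sum.cong[OF refl], rule sum.cong[OF refl], rule sum.swap)
      finally show ?thesis .
    qed
    then show ?thesis unfolding product_form_def by simp
  qed
  finally have "Re (mat_trace (M * Y)) = Re (product_form dA dB \<rho> (outer v) (outer w)) / (real dA * real dB)"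
    by (simp only: Re_divide_of_real)
  moreover have "quantum_correlation dA dB \<rho> 1 1 v w = Re (mat_trace (M * Y))"
    by (simp add: quantum_correlation_def max_entangled_effect_def M_def Y_def)
  ultimately show ?thesis by simp
qed

section \<open>Pure states and unit vectors\<close>

lemma quantum_state_ketbra:
  assumes "unit_ket d v"
  shows "quantum_state d (ketbra v)"
proof -
  have v: "dim_vec v = d" "v \<bullet>c v = 1" using assms by (auto simp: unit_ket_def)
  have "0 \<le> Re ((ketbra v *\<^sub>v x) \<bullet>c x)" if "x \<in> carrier_vec d" for x
  proof -
    have "(ketbra v *\<^sub>v x) \<bullet>c x = (\<Sum>i<d. \<Sum>j<d. (v $ i * cnj (x $ i)) * cnj (v $ j * cnj (x $ j)))"
    proof -
      have "(ketbra v *\<^sub>v x) \<bullet>c x = (\<Sum>i<d. (\<Sum>j<d. v $ i * cnj (v $ j) * x $ j) * cnj (x $ i))"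
        using v(1) that by (simp add: scalar_prod_def atLeast0LessThan carrier_vecD)
      then show ?thesis
        by (simp only: sum_distrib_right) (simp add: mult_ac)
    qed
    also have "\<dots> = complex_of_real ((cmod (\<Sum>i<d. v $ i * cnj (x $ i)))\<^sup>2)"
      by (simp only: complex_norm_square cnj_sum sum_product)
    finally show ?thesis by (simp del: of_real_power)
  qed
  moreover have "mat_adjoint (ketbra v) = ketbra v"
    by (rule eq_matI) (auto simp: index_mat_adjoint)
  moreover have "ketbra v \<in> carrier_mat d d" using v by (auto intro: carrier_matI)
  moreover have "mat_trace (ketbra v) = 1"
    using v by (simp add: mat_trace_def scalar_prod_def atLeast0LessThan)
  ultimately show ?thesis
    by (simp add: quantum_state_def positive_semidefinite_def)
qed

text \<open>The bound on all coordinates, also those from \<open>d\<close> on, makes this set compact.\<close>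

definition unit_sphere :: "nat \<Rightarrow> (nat \<Rightarrow> complex) set" where
  "unit_sphere d = {a. (\<forall>i. a i \<in> cball 0 1) \<and> (\<Sum>i<d. (cmod (a i))\<^sup>2) = 1}"

lemma compact_unit_sphere: "compact (unit_sphere d)"
proof -
  have "unit_sphere d = {a. \<forall>i. a i \<in> cball 0 1} \<inter> {a. (\<Sum>i<d. (cmod (a i))\<^sup>2) = 1}"
    by (auto simp: unit_sphere_def)
  also have "compact \<dots>"
    by (intro compact_Int_closed compact_Pi_UNIV compact_cball closed_Collect_eq continuous_on_sum
        continuous_on_power continuous_on_norm continuous_on_const continuous_on_product_coordinates)
  finally show ?thesis .
qed

lemma unit_sphere_nonempty: "0 < d \<Longrightarrow> unit_sphere d \<noteq> {}"
proof -
  assume "0 < d"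
  then have "(\<lambda>i. of_bool (i = 0)) \<in> unit_sphere d"
    by (simp add: unit_sphere_def of_bool_def if_distrib[of "\<lambda>x. x\<^sup>2"] if_distrib[of cmod] cong: if_cong)
  then show ?thesis by blast
qed

text \<open>Normalisation, with the zero vector as the second alternative. It serves to extend
  inequalities from the unit sphere to all vectors by homogeneity.\<close>

lemma scaled_unit_sphere:
  obtains r a where "a \<in> unit_sphere d" "\<And>i. i < d \<Longrightarrow> f i = complex_of_real r * a i"
  | "\<And>i. i < d \<Longrightarrow> f i = 0"
proof (cases "(\<Sum>i<d. (cmod (f i))\<^sup>2) = 0")
  case True
  then have "f i = 0" if "i < d" for i
    using that by (subst (asm) sum_nonneg_eq_0_iff) auto
  then show thesis by (rule that(2))
next
  case False
  define N where "N = (\<Sum>i<d. (cmod (f i))\<^sup>2)"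
  \<comment> \<open>The value 0 from \<open>d\<close> on keeps every coordinate in the unit ball, as
    \<open>unit_sphere\<close> demands.\<close>
  define a where "a i = (if i < d then f i / complex_of_real (sqrt N) else 0)" for i
  have "N > 0" using False by (simp add: N_def less_le sum_nonneg)
  have sq: "(cmod (a i))\<^sup>2 = (cmod (f i))\<^sup>2 / N" if "i < d" for i
    using that \<open>N > 0\<close> by (simp add: a_def norm_divide power_divide)
  have one: "(\<Sum>i<d. (cmod (a i))\<^sup>2) = 1"
    using \<open>N > 0\<close> by (simp add: sq N_def flip: sum_divide_distrib)
  have "cmod (a i) \<le> 1" for i
  proof (cases "i < d")
    case True
    then have "(cmod (a i))\<^sup>2 \<le> 1"
      unfolding one[symmetric] by (intro member_le_sum) auto
    then show ?thesis using power2_le_imp_le[of "cmod (a i)" 1] by simp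
  qed (simp add: a_def)
  with one have "a \<in> unit_sphere d" by (simp add: unit_sphere_def)
  moreover have "f i = complex_of_real (sqrt N) * a i" if "i < d" for i
    using that \<open>N > 0\<close> by (simp add: a_def)
  ultimately show thesis by (rule that(1))
qed

lemma unit_ket_vec: "a \<in> unit_sphere d \<Longrightarrow> unit_ket d (vec d a)"
proof -
  assume "a \<in> unit_sphere d"
  then have "complex_of_real (\<Sum>i<d. (cmod (a i))\<^sup>2) = 1" by (simp add: unit_sphere_def)
  then show ?thesis
    by (simp add: unit_ket_def scalar_prod_def atLeast0LessThan complex_norm_square del: of_real_power)
qed

section \<open>The functional separating an entangled state from LOCC correlations\<close>

theorem theorem1:
  fixes dA dB :: nat and \<rho> :: "complex mat" and \<phi> \<psi> :: "nat \<Rightarrow> complex vec"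
  assumes "1 \<le> dA" and "1 \<le> dB"
    and "entangled_state dA dB \<rho>"
    and "\<forall>s\<in>{1..dA\<^sup>2}. unit_ket dA (\<phi> s)"
    and "\<forall>t\<in>{1..dB\<^sup>2}. unit_ket dB (\<psi> t)"
    and "informationally_complete dA {1..dA\<^sup>2} \<phi>"
    and "informationally_complete dB {1..dB\<^sup>2} \<psi>"
  shows "\<exists>\<beta> :: nat \<Rightarrow> nat \<Rightarrow> real.
    (\<forall>P. locc_correlation dA dB (\<phi> ` {1..dA\<^sup>2}) (\<psi> ` {1..dB\<^sup>2}) P \<longrightarrow>
      (\<Sum>s\<in>{1..dA\<^sup>2}. \<Sum>t\<in>{1..dB\<^sup>2}. \<beta> s t * P 1 1 (\<phi> s) (\<psi> t)) \<ge> 0) \<and>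
    (\<Sum>s\<in>{1..dA\<^sup>2}. \<Sum>t\<in>{1..dB\<^sup>2}.
      \<beta> s t * quantum_correlation dA dB \<rho> 1 1 (\<phi> s) (\<psi> t)) < 0"
proof -
  define S T where "S = {1..dA\<^sup>2}" and "T = {1..dB\<^sup>2}"
  have \<phi>: "s \<in> S \<Longrightarrow> dim_vec (\<phi> s) = dA" and \<psi>: "t \<in> T \<Longrightarrow> dim_vec (\<psi> t) = dB" for s t
    using assms by (auto simp: S_def T_def unit_ket_def)
  have icA: "informationally_complete dA S \<phi>" and icB: "informationally_complete dB T \<psi>"
    using assms by (auto simp: S_def T_def)
  have \<rho>: "\<rho> \<in> carrier_mat (dA * dB) (dA * dB)" "mat_adjoint \<rho> = \<rho>" "mat_trace \<rho> = 1"
    and not_sep: "\<not> separable_state dA dB \<rho>"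
    using assms(3) by (auto simp: entangled_state_def quantum_state_def positive_semidefinite_def)
  \<comment> \<open>By \<open>product_form_kron_ketbra\<close>, \<open>g (a, b)\<close> lists the
    values of the form at the inputs for the pure product state of \<open>a\<close> and
    \<open>b\<close>; \<open>p\<close> does so for \<rho>.\<close>
  define g where "g = (\<lambda>(a, b) (s, t).
    (cmod (\<Sum>i<dA. a i * \<phi> s $ i))\<^sup>2 * (cmod (\<Sum>j<dB. b j * \<psi> t $ j))\<^sup>2)"
  define p where "p = (\<lambda>(s, t). Re (product_form dA dB \<rho> (outer (\<phi> s)) (outer (\<psi> t))))"
  \<comment> \<open>The products \<open>cA s * cB t\<close> express the trace through the values at
    the inputs and become the functional \<open>w\<close> of the separation.\<close>
  obtain cA :: "nat \<Rightarrow> real" where cA: "\<And>i k. i < dA \<Longrightarrow> k < dA \<Longrightarrow>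
      (\<Sum>s\<in>S. complex_of_real (cA s) * outer (\<phi> s) i k) = of_bool (i = k)"
    using identity_real_coefficients[OF icA \<phi>] by blast
  obtain cB :: "nat \<Rightarrow> real" where cB: "\<And>j l. j < dB \<Longrightarrow> l < dB \<Longrightarrow>
      (\<Sum>t\<in>T. complex_of_real (cB t) * outer (\<psi> t) j l) = of_bool (j = l)"
    using identity_real_coefficients[OF icB \<psi>] by blast
  obtain \<beta> where \<beta>: "\<And>x. x \<in> unit_sphere dA \<times> unit_sphere dB \<Longrightarrow> 0 \<le> (\<Sum>z\<in>S \<times> T. \<beta> z * g x z)"
    and \<beta>_neg: "(\<Sum>z\<in>S \<times> T. \<beta> z * p z) < 0"
  proof (rule separation_from_compact_family[where I = "S \<times> T" and X = "unit_sphere dA \<times> unit_sphere dB"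
        and g = g and p = p and w = "\<lambda>(s, t). cA s * cB t"])
    show "finite (S \<times> T)" "S \<times> T \<noteq> {}"
      using assms(1,2) by (auto simp: S_def T_def)
    show "compact (unit_sphere dA \<times> unit_sphere dB)"
      by (intro compact_Times compact_unit_sphere)
    show "unit_sphere dA \<times> unit_sphere dB \<noteq> {}"
      using assms(1,2) unit_sphere_nonempty by (auto simp: Suc_le_eq)
    show "continuous_on (unit_sphere dA \<times> unit_sphere dB) (\<lambda>x. g x z)" for z
    proof -
      have fst: "continuous_on X (\<lambda>x. fst x k)" for k and X :: "((nat \<Rightarrow> complex) \<times> (nat \<Rightarrow> complex)) set"
        by (rule continuous_on_compose2[OF continuous_on_product_coordinates continuous_on_fst])
          (auto intro: continuous_intros)
      have snd: "continuous_on X (\<lambda>x. snd x k)" for k and X :: "((nat \<Rightarrow> complex) \<times> (nat \<Rightarrow> complex)) set"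
        by (rule continuous_on_compose2[OF continuous_on_product_coordinates continuous_on_snd])
          (auto intro: continuous_intros)
      show ?thesis
        unfolding g_def case_prod_unfold
        by (intro continuous_on_mult continuous_on_power continuous_on_norm continuous_on_sum
            continuous_on_const fst snd)
    qed
    show "(\<Sum>z\<in>S \<times> T. (\<lambda>(s, t). cA s * cB t) z * g x z) = 1"
      if x_in: "x \<in> unit_sphere dA \<times> unit_sphere dB" for x
    proof -
      obtain a b where x: "x = (a, b)" "a \<in> unit_sphere dA" "b \<in> unit_sphere dB"
        using x_in by blast
      have "(\<Sum>z\<in>S \<times> T. (\<lambda>(s, t). cA s * cB t) z * g x z)
        = (\<Sum>s\<in>S. cA s * (cmod (\<Sum>i<dA. a i * \<phi> s $ i))\<^sup>2) *
          (\<Sum>t\<in>T. cB t * (cmod (\<Sum>j<dB. b j * \<psi> t $ j))\<^sup>2)"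
        unfolding sum_product sum.cartesian_product
        by (intro sum.cong refl) (auto simp: g_def x)
      then show ?thesis
        using x by (simp add: identity_coefficients_norm[OF cA] identity_coefficients_norm[OF cB] unit_sphere_def)
    qed
    show "(\<Sum>z\<in>S \<times> T. (\<lambda>(s, t). cA s * cB t) z * p z) = 1"
    proof -
      have "(\<Sum>z\<in>S \<times> T. (\<lambda>(s, t). cA s * cB t) z * p z)
        = Re (\<Sum>s\<in>S. \<Sum>t\<in>T. complex_of_real (cA s) * complex_of_real (cB t) *
            product_form dA dB \<rho> (outer (\<phi> s)) (outer (\<psi> t)))"
        unfolding sum.cartesian_product Re_sum
        by (intro sum.cong refl) (auto simp: p_def simp flip: of_real_mult)
      also have "\<dots> = Re (product_form dA dB \<rho> (\<lambda>i k. of_bool (i = k)) (\<lambda>j l. of_bool (j = l)))"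
        by (subst product_form_lincomb[OF cA cB]) simp_all
      also have "\<dots> = 1"
        using \<rho> by (simp add: product_form_identity)
      finally show ?thesis .
    qed
    fix n :: nat and c :: "nat \<Rightarrow> real" and x :: "nat \<Rightarrow> _"
    assume c: "\<And>k. 0 \<le> c k" "(\<Sum>k<n. c k) = 1" and x: "\<And>k. x k \<in> unit_sphere dA \<times> unit_sphere dB"
    \<comment> \<open>If \<open>p\<close> were such a combination, the separable operator
      \<open>\<rho>'\<close> would have the same values as \<rho> at all inputs, and informational
      completeness would force them to be equal.\<close>
    show "\<exists>z\<in>S \<times> T. p z \<noteq> (\<Sum>k<n. c k * g (x k) z)"
    proof (rule ccontr)
      assume "\<not> ?thesis"
      then have eq: "p (s, t) = (\<Sum>k<n. c k * g (x k) (s, t))" if "s \<in> S" "t \<in> T" for s t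
        using that by auto
      define a b where "a k = vec dA (fst (x k))" and "b k = vec dB (snd (x k))" for k
      define \<rho>' where "\<rho>' = mat_sum (dA * dB) (dA * dB)
        (\<lambda>k. complex_of_real (c k) \<cdot>\<^sub>m kron_mat (ketbra (a k)) (ketbra (b k))) {..<n}"
      have "\<rho> = \<rho>'"
      proof (rule product_form_eqI[OF icA \<phi> icB \<psi> \<rho>(1)])
        show "\<rho>' \<in> carrier_mat (dA * dB) (dA * dB)" by (simp add: \<rho>'_def mat_sum_def)
        fix s t assume st: "s \<in> S" "t \<in> T"
        have "product_form dA dB \<rho>' (outer (\<phi> s)) (outer (\<psi> t))
          = (\<Sum>k<n. complex_of_real (c k) * complex_of_real (g (x k) (s, t)))"
          unfolding \<rho>'_def
          by (subst product_form_mat_sum)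
            (auto simp: product_form_kron_ketbra a_def b_def g_def case_prod_unfold intro!: carrier_matI)
        also have "\<dots> = complex_of_real (p (s, t))"
          by (simp add: eq[OF st])
        also have "\<dots> = product_form dA dB \<rho> (outer (\<phi> s)) (outer (\<psi> t))"
          using product_form_hermitian_real[OF \<rho>(1,2)] by (simp add: p_def)
        finally show "product_form dA dB \<rho> (outer (\<phi> s)) (outer (\<psi> t))
          = product_form dA dB \<rho>' (outer (\<phi> s)) (outer (\<psi> t))" ..
      qed
      moreover have "quantum_state dA (ketbra (a k))" "quantum_state dB (ketbra (b k))" for k
        using x[of k] by (auto simp: a_def b_def intro!: quantum_state_ketbra unit_ket_vec)
      ultimately have "separable_state dA dB \<rho>"
        unfolding separable_state_def using c
        by (intro exI[of _ n] exI[of _ c] exI[of _ "\<lambda>k. ketbra (a k)"]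
            exI[of _ "\<lambda>k. ketbra (b k)"]) (simp add: \<rho>'_def)
      with not_sep show False ..
    qed
  qed blast
  \<comment> \<open>Rows of Kraus operators need not be unit vectors; both sides scale with the
    squared norms, so positivity on the unit spheres suffices.\<close>
  have pos: "0 \<le> (\<Sum>z\<in>S \<times> T. \<beta> z * ((cmod (x \<bullet> \<phi> (fst z)))\<^sup>2 * (cmod (y \<bullet> \<psi> (snd z)))\<^sup>2))" for x y
  proof -
    have sp: "(\<Sum>z\<in>S \<times> T. \<beta> z * ((cmod (x \<bullet> \<phi> (fst z)))\<^sup>2 * (cmod (y \<bullet> \<psi> (snd z)))\<^sup>2))
      = (\<Sum>z\<in>S \<times> T. \<beta> z * g (($) x, ($) y) z)"
      by (intro sum.cong refl) (auto simp: g_def scalar_prod_def atLeast0LessThan \<phi> \<psi>)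
    consider r a r' b where "a \<in> unit_sphere dA" "\<And>i. i < dA \<Longrightarrow> x $ i = complex_of_real r * a i"
        "b \<in> unit_sphere dB" "\<And>i. i < dB \<Longrightarrow> y $ i = complex_of_real r' * b i"
      | "\<And>i. i < dA \<Longrightarrow> x $ i = 0" | "\<And>i. i < dB \<Longrightarrow> y $ i = 0"
      by (rule scaled_unit_sphere[of dA "($) x"]; rule scaled_unit_sphere[of dB "($) y"]; blast)
    then show ?thesis
    proof cases
      case 1
      have "g (($) x, ($) y) z = (r\<^sup>2 * r'\<^sup>2) * g (a, b) z" for z
        using 1 by (simp add: g_def case_prod_unfold mult.assoc norm_mult power_mult_distrib flip: sum_distrib_left)
      then have "(\<Sum>z\<in>S \<times> T. \<beta> z * g (($) x, ($) y) z) = (r\<^sup>2 * r'\<^sup>2) * (\<Sum>z\<in>S \<times> T. \<beta> z * g (a, b) z)"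
        by (simp add: sum_distrib_left mult_ac)
      then show ?thesis
        using \<beta>[of "(a, b)"] 1 unfolding sp by simp
    qed (simp_all add: sp g_def case_prod_unfold)
  qed
  show ?thesis
  proof (intro exI[of _ "\<lambda>s t. \<beta> (s, t)"] conjI allI impI)
    fix P assume P: "locc_correlation dA dB (\<phi> ` {1..dA\<^sup>2}) (\<psi> ` {1..dB\<^sup>2}) P"
    have "0 \<le> (\<Sum>z\<in>S \<times> T. \<beta> z * P 1 1 (\<phi> (fst z)) (\<psi> (snd z)))"
      by (rule locc_functional_nonneg[OF pos _ _ P])
        (auto simp: S_def T_def intro!: carrier_vecI \<phi>[unfolded S_def] \<psi>[unfolded T_def])
    then show "0 \<le> (\<Sum>s\<in>{1..dA\<^sup>2}. \<Sum>t\<in>{1..dB\<^sup>2}. \<beta> (s, t) * P 1 1 (\<phi> s) (\<psi> t))"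
      by (simp add: S_def T_def sum.cartesian_product case_prod_unfold)
  next
    \<comment> \<open>The quantum correlation is \<open>p\<close> up to a positive factor, which
      does not affect the sign.\<close>
    have "(\<Sum>s\<in>S. \<Sum>t\<in>T. \<beta> (s, t) * quantum_correlation dA dB \<rho> 1 1 (\<phi> s) (\<psi> t))
      = (\<Sum>s\<in>S. \<Sum>t\<in>T. \<beta> (s, t) * p (s, t)) / (real dA * real dB)"
      unfolding sum_divide_distrib
    proof (intro sum.cong refl)
      fix s t assume "s \<in> S" "t \<in> T"
      then have "quantum_correlation dA dB \<rho> 1 1 (\<phi> s) (\<psi> t) = p (s, t) / (real dA * real dB)"
        unfolding p_def prod.case
        using \<rho>(1) \<phi> \<psi> by (intro quantum_correlation_eq_product_form) auto
      then show "\<beta> (s, t) * quantum_correlation dA dB \<rho> 1 1 (\<phi> s) (\<psi> t)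
          = \<beta> (s, t) * p (s, t) / (real dA * real dB)"
        by simp
    qed
    also have "\<dots> < 0"
      using \<beta>_neg assms(1,2)
      by (intro divide_neg_pos) (simp_all add: sum.cartesian_product case_prod_unfold)
    finally show "(\<Sum>s\<in>{1..dA\<^sup>2}. \<Sum>t\<in>{1..dB\<^sup>2}.
        \<beta> (s, t) * quantum_correlation dA dB \<rho> 1 1 (\<phi> s) (\<psi> t)) < 0"
      by (simp add: S_def T_def)
  qed
qed

end
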